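(* Given positive item weights $w_1,\dots,w_n$, an alias table for them can be constructed on a CREW PRAM with work $\Theta(n)$ and span $\Theta(\log n)$.
   Context: Let $W=\sum_{i=1}^n w_i$. An alias table for weights $w_1,\dots,w_n$ is an array of $n$ buckets $b[1..n]$, where bucket $b[i]$ stores a weight $b[i].w\in[0,W/n]$ and an alias index $b[i].a\in\{1,\dots,n\}$, such that the following sampling procedure returns each item $j$ with probability exactly $w_j/W$: pick $r\in\{1,\dots,n\}$ uniformly at random, return $r$ with probability $b[r].w\cdot n/W$ and otherwise return $b[r].a$. In the CREW PRAM model (concurrent read, exclusive write parallel random access machine), the work of an algorithm is the total number of operations performed and the span is its running time with an unbounded number of processors. *)

theory Defs
  imports "HOL-Probability.Probability_Mass_Function" "HOL-Library.Landau_Symbols"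
begin

section \<open>Alias tables\<close>

record bucket =
  weight :: real
  alias_index :: nat

definition total_weight :: "nat \<Rightarrow> (nat \<Rightarrow> real) \<Rightarrow> real" where
  "total_weight n w = (\<Sum>i = 1..n. w i)"

text \<open>
  Arrays are functions on the index set {1..n}; values outside are irrelevant. The coin has
  bias in [0,1] for the bucket weights that \<open>alias_table\<close> admits, so the clamping done
  by \<open>bernoulli_pmf\<close> plays no role there.
\<close>

definition alias_sample :: "nat \<Rightarrow> (nat \<Rightarrow> real) \<Rightarrow> (nat \<Rightarrow> bucket) \<Rightarrow> nat pmf" where
  "alias_sample n w b =
     bind_pmf (pmf_of_set {1..n}) (\<lambda>r.
     bind_pmf (bernoulli_pmf (weight (b r) * real n / total_weight n w)) (\<lambda>stay.
     return_pmf (if stay then r else alias_index (b r))))"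

definition alias_table :: "nat \<Rightarrow> (nat \<Rightarrow> real) \<Rightarrow> (nat \<Rightarrow> bucket) \<Rightarrow> bool" where
  "alias_table n w b \<longleftrightarrow>
     (\<forall>i\<in>{1..n}. weight (b i) \<in> {0..total_weight n w / real n} \<and> alias_index (b i) \<in> {1..n}) \<and>
     (\<forall>j\<in>{1..n}. pmf (alias_sample n w b) j = w j / total_weight n w)"


section \<open>A CREW PRAM\<close>

text \<open>
  A synchronous machine with processors 0, 1, 2, ... that share one memory. All of them run the
  same program, each with its own control and its own registers, and each active processor
  performs exactly one operation per time step. Initially only processor 0 is active; a processor
  activates another one with \<open>Fork\<close> and becomes inactive when its program ends.

  Registers and memory cells hold either natural numbers or reals. Shared memory consists of
  arrays. Array names and register names are fixed in the program text, so a program uses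
  finitely many of each; interleaving the arrays yields an ordinary flat memory.

  The instruction set is deliberately weak, to rule out the encoding of large data in a single
  cell. On naturals there are only addition, truncated subtraction and halving, so a run of T steps
  on numbers of b bits creates only numbers of O(b + T) bits. On reals there are exact
  field operations (with division by 0 yielding 0) and comparison, but no real constants, no
  rounding and no conversion to naturals.
\<close>

datatype cond =
    NLess nat nat
  | RLess nat nat

text \<open>In every assignment the destination register comes first.\<close>

datatype stmt =
    NConst nat nat
  | NAdd nat nat nat
  | NSub nat nat nat
  | NHalf nat nat
  | Pid nat           \<comment> \<open>the number of the executing processor\<close>
  | RCast nat nat     \<comment> \<open>from a natural-number register to a real register\<close>
  | RAdd nat nat nat
  | RSub nat nat nat
  | RMul nat nat nat
  | RDiv nat nat nat
  | NLoad nat nat nat   \<comment> \<open>\<open>NLoad x a y\<close>: x := a[y]\<close>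
  | RLoad nat nat nat
  | NStore nat nat nat  \<comment> \<open>\<open>NStore a y x\<close>: a[y] := x\<close>
  | RStore nat nat nat
  | Fork nat            \<comment> \<open>\<open>Fork y\<close>: activate the processor whose number is in register y\<close>
  | Branch cond "stmt list" "stmt list"
  | Loop cond "stmt list"

record memory =
  nmem :: "nat \<Rightarrow> nat \<Rightarrow> nat"
  rmem :: "nat \<Rightarrow> nat \<Rightarrow> real"

text \<open>A processor is given by the rest of its program and its two register banks.\<close>

type_synonym processor = "stmt list \<times> (nat \<Rightarrow> nat) \<times> (nat \<Rightarrow> real)"

type_synonym config = "memory \<times> (nat \<Rightarrow> processor)"

datatype effect =
    Silent
  | WriteN nat nat nat
  | WriteR nat nat real
  | Activate nat

fun holds :: "cond \<Rightarrow> (nat \<Rightarrow> nat) \<Rightarrow> (nat \<Rightarrow> real) \<Rightarrow> bool" where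
  "holds (NLess x y) s r \<longleftrightarrow> s x < s y"
| "holds (RLess x y) s r \<longleftrightarrow> r x < r y"

fun local_step :: "memory \<Rightarrow> nat \<Rightarrow> processor \<Rightarrow> processor \<times> effect" where
  "local_step M i ([], s, r) = (([], s, r), Silent)"
| "local_step M i (NConst x c # k, s, r) = ((k, s(x := c), r), Silent)"
| "local_step M i (NAdd x y z # k, s, r) = ((k, s(x := s y + s z), r), Silent)"
| "local_step M i (NSub x y z # k, s, r) = ((k, s(x := s y - s z), r), Silent)"
| "local_step M i (NHalf x y # k, s, r) = ((k, s(x := s y div 2), r), Silent)"
| "local_step M i (Pid x # k, s, r) = ((k, s(x := i), r), Silent)"
| "local_step M i (RCast x y # k, s, r) = ((k, s, r(x := real (s y))), Silent)"
| "local_step M i (RAdd x y z # k, s, r) = ((k, s, r(x := r y + r z)), Silent)"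
| "local_step M i (RSub x y z # k, s, r) = ((k, s, r(x := r y - r z)), Silent)"
| "local_step M i (RMul x y z # k, s, r) = ((k, s, r(x := r y * r z)), Silent)"
| "local_step M i (RDiv x y z # k, s, r) = ((k, s, r(x := r y / r z)), Silent)"
| "local_step M i (NLoad x a y # k, s, r) = ((k, s(x := nmem M a (s y)), r), Silent)"
| "local_step M i (RLoad x a y # k, s, r) = ((k, s, r(x := rmem M a (s y))), Silent)"
| "local_step M i (NStore a y x # k, s, r) = ((k, s, r), WriteN a (s y) (s x))"
| "local_step M i (RStore a y x # k, s, r) = ((k, s, r), WriteR a (s y) (r x))"
| "local_step M i (Fork y # k, s, r) = ((k, s, r), Activate (s y))"
| "local_step M i (Branch c p q # k, s, r) = (((if holds c s r then p else q) @ k, s, r), Silent)"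
| "local_step M i (Loop c p # k, s, r) =
     ((if holds c s r then p @ Loop c p # k else k, s, r), Silent)"

definition active :: "config \<Rightarrow> nat set" where
  "active C = {i. fst (snd C i) \<noteq> []}"

definition succ :: "config \<Rightarrow> nat \<Rightarrow> processor" where
  "succ C i = fst (local_step (fst C) i (snd C i))"

definition eff :: "config \<Rightarrow> nat \<Rightarrow> effect" where
  "eff C i = snd (local_step (fst C) i (snd C i))"

text \<open>
  Simultaneous reads of a cell are unrestricted, and all reads of a step precede its writes.
  Two processors must not write to the same cell in the same step. Likewise no processor may be
  activated by two others at once, or while it is still active.
\<close>

fun clash :: "effect \<Rightarrow> effect \<Rightarrow> bool" where
  "clash (WriteN a i _) (WriteN b j _) \<longleftrightarrow> a = b \<and> i = j"
| "clash (WriteR a i _) (WriteR b j _) \<longleftrightarrow> a = b \<and> i = j"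
| "clash (Activate i) (Activate j) \<longleftrightarrow> i = j"
| "clash _ _ \<longleftrightarrow> False"

definition exclusive_write :: "config \<Rightarrow> bool" where
  "exclusive_write C \<longleftrightarrow>
     (\<forall>i j. i \<noteq> j \<longrightarrow> \<not> clash (eff C i) (eff C j)) \<and>
     (\<forall>i j. eff C i = Activate j \<longrightarrow> j \<notin> active C)"

text \<open>
  The definite descriptions are well defined whenever \<open>exclusive_write C\<close>, the only case in
  which a run uses \<open>step C\<close>. An activated processor continues with the program and the
  registers of its activator; \<open>Pid\<close> tells the two apart.
\<close>

definition step :: "config \<Rightarrow> config" where
  "step C =
     (\<lparr>nmem = (\<lambda>a k. if \<exists>i v. eff C i = WriteN a k v then (THE v. \<exists>i. eff C i = WriteN a k v)
                     else nmem (fst C) a k),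
       rmem = (\<lambda>a k. if \<exists>i v. eff C i = WriteR a k v then (THE v. \<exists>i. eff C i = WriteR a k v)
                     else rmem (fst C) a k)\<rparr>,
      (\<lambda>j. if \<exists>i. eff C i = Activate j then succ C (THE i. eff C i = Activate j)
           else succ C j))"

text \<open>
  \<open>crew_run C wk t C'\<close>: the machine, started in C, halts in C' without a write
  conflict after \<open>t\<close> time steps, in which its processors perform \<open>wk\<close>
  operations altogether.
\<close>

inductive crew_run :: "config \<Rightarrow> nat \<Rightarrow> nat \<Rightarrow> config \<Rightarrow> bool" where
  halt: "active C = {} \<Longrightarrow> crew_run C 0 0 C"
| step: "active C \<noteq> {} \<Longrightarrow> exclusive_write C \<Longrightarrow> crew_run (step C) wk t C' \<Longrightarrow>
         crew_run C (card (active C) + wk) (Suc t) C'"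


section \<open>Input, output and asymptotics\<close>

text \<open>
  Input: n in cell 0 of natural-number array 0, the weights in cells 1..n of real array 0; all
  other cells and all registers are 0. Output: bucket i has its weight in cell i of real
  array 1 and its alias in cell i of natural-number array 1.
\<close>

definition input_config :: "stmt list \<Rightarrow> nat \<Rightarrow> (nat \<Rightarrow> real) \<Rightarrow> config" where
  "input_config P n w =
     (\<lparr>nmem = (\<lambda>a k. if a = 0 \<and> k = 0 then n else 0),
       rmem = (\<lambda>a k. if a = 0 \<and> k \<in> {1..n} then w k else 0)\<rparr>,
      (\<lambda>i. (if i = 0 then P else [], (\<lambda>_. 0), (\<lambda>_. 0))))"

definition output_table :: "config \<Rightarrow> nat \<Rightarrow> bucket" where
  "output_table C i = \<lparr>weight = rmem (fst C) 1 i, alias_index = nmem (fst C) 1 i\<rparr>"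

definition instances :: "(nat \<times> (nat \<Rightarrow> real)) set" where
  "instances = {(n, w). 1 \<le> n \<and> (\<forall>i\<in>{1..n}. 0 < w i)}"

text \<open>
  A property holds eventually along this filter iff there is an N such that it holds for all
  instances with n at least N, uniformly in the weights.
\<close>

definition large_instances :: "(nat \<times> (nat \<Rightarrow> real)) filter" where
  "large_instances = inf (filtercomap fst at_top) (principal instances)"

lemma eventually_large_instances:
  "eventually Q large_instances \<longleftrightarrow> (\<exists>N. \<forall>(n, w)\<in>instances. N \<le> n \<longrightarrow> Q (n, w))"
  unfolding large_instances_def eventually_inf_principal eventually_filtercomap
    eventually_at_top_linorder
  by (auto 0 4)

end

theory Submission
  imports Defs
begin

text \<open>
  Call an item light or heavy according to whether its weight is at most or above the average
  \<open>a = W / n\<close>, let \<open>X i\<close> be the total deficit (\<open>a\<close> minus the weight) of the light items before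
  \<open>i\<close>, and \<open>Y j\<close> the total surplus of the heavy items up to \<open>j\<close>. The sequential sweep, which fills the
  buckets of the light items from the current heavy item and lets a heavy item that drops below the
  average be filled up by the next one, has a closed form: a light item \<open>i\<close> keeps its weight and has
  as alias the first \<open>j\<close> with \<open>X i < Y j\<close>; a heavy item \<open>j\<close> keeps \<open>a + Y j - X i\<close>, where \<open>i\<close>
  is the first index with \<open>Y j \<le> X i\<close>, and has the next heavy item as alias. All these
  searches are one merge of the monotone sequences \<open>X\<close> and \<open>Y\<close>.

  On the machine, about \<open>n / log n\<close> processors own blocks of about \<open>log n\<close> items each. Block sums and
  a scan over the processors yield \<open>X\<close>, \<open>Y\<close> and the predecessor of every heavy item. Each
  processor then finds its starting point on the merge path by binary search and performs an equal
  share of the merge steps. The program is written so that all processors run in lockstep: loop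
  counts depend on \<open>n\<close> only, and both arms of a branch take one step.
\<close>

section \<open>Lockstep execution\<close>

text \<open>The block length balances two costs. The scan and the binary search take about
  \<open>L\<close> steps on each of \<open>p\<close> processors, so linear work needs
  \<open>p\<close> to be O(n / log n); the passes take about \<open>B\<close> steps, so logarithmic
  span needs \<open>B\<close> to be O(log n). A closed form is needed because the state of the
  sequential sweep at a late item depends on all earlier ones; on the merge path this state is found
  by testing a monotone predicate. Exclusive writing follows from the same picture: each merge step
  advances exactly one of the two sequences, so no index is handled twice. Padding to
  \<open>N = p * B\<close>, a power of two with \<open>2 * n + 2 \<le> N\<close> and
  \<open>N \<le> 4 * n\<close>, makes bounds checks unnecessary; padded items have weight 0 and are
  neither light nor heavy. Powers of two suit a machine that has neither multiplication nor
  logarithms on naturals. The lower bounds are cheap: one pass costs at least \<open>p * B\<close>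
  operations, and the loop that computes \<open>N\<close> takes \<open>L - 1\<close> rounds.\<close>

inductive steps :: "config \<Rightarrow> nat \<Rightarrow> nat \<Rightarrow> config \<Rightarrow> bool" where
  steps_refl: "steps C 0 0 C"
| steps_step: "active C \<noteq> {} \<Longrightarrow> exclusive_write C \<Longrightarrow> steps (step C) wk t C' \<Longrightarrow>
     steps C (card (active C) + wk) (Suc t) C'"

text \<open>Composition is the reason for \<open>steps\<close>: it is \<open>crew_run\<close>
  without the demand that the machine halts.\<close>

lemma steps_trans:
  "steps C wk t C' \<Longrightarrow> steps C' wk' t' C'' \<Longrightarrow> steps C (wk + wk') (t + t') C''"
proof (induction rule: steps.induct)
  case (steps_step C wk t C')
  from steps.steps_step[OF steps_step.hyps(1,2) steps_step.IH[OF steps_step.prems]]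
  show ?case by (simp add: add.assoc)
qed simp

lemma crew_run_steps:
  "steps C wk t C' \<Longrightarrow> active C' = {} \<Longrightarrow> crew_run C wk t C'"
  by (induction rule: steps.induct) (auto intro: crew_run.intros)

type_synonym state = "memory \<times> (nat \<Rightarrow> nat \<Rightarrow> nat) \<times> (nat \<Rightarrow> nat \<Rightarrow> real)"

text \<open>Only processors 0, ..., p - 1 are active; the registers of the others are irrelevant.\<close>

definition rep :: "nat \<Rightarrow> (nat \<Rightarrow> stmt list) \<Rightarrow> state \<Rightarrow> config \<Rightarrow> bool" where
  "rep p c S C \<longleftrightarrow> (case S of (M, s, r) \<Rightarrow> fst C = M \<and>
     (\<forall>i. if i < p then snd C i = (c i, s i, r i) else fst (snd C i) = []))"

lemma active_rep: "rep p c S C \<Longrightarrow> (\<And>i. i < p \<Longrightarrow> c i \<noteq> []) \<Longrightarrow> active C = {..<p}"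
  by (cases S) (auto simp: rep_def active_def split: if_splits)

lemma idle_rep:
  assumes "rep p c S C" "\<not> i < p"
  shows "eff C i = Silent" "succ C i = snd C i"
proof -
  obtain x y z where C: "snd C i = (x, y, z)" by (cases "snd C i")
  then have "x = []" using assms by (auto simp: rep_def split: prod.splits dest: spec[of _ i])
  then show "eff C i = Silent" "succ C i = snd C i" by (simp_all add: eff_def succ_def C)
qed

lemma busy_rep:
  assumes "rep p c (M, s, r) C" "i < p"
  shows "eff C i = snd (local_step M i (c i, s i, r i))" "succ C i = fst (local_step M i (c i, s i, r i))"
  using assms by (simp_all add: rep_def eff_def succ_def)

text \<open>The effect on an array of one store instruction executed by all processors at once,
  \<open>D\<close> selecting those that write. The definite description denotes when
  \<open>ad\<close> is injective on the writers, which is the exclusive-write condition for this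
  store.\<close>

definition scatter :: "nat \<Rightarrow> (nat \<Rightarrow> bool) \<Rightarrow> (nat \<Rightarrow> nat) \<Rightarrow> (nat \<Rightarrow> 'b) \<Rightarrow> (nat \<Rightarrow> 'b) \<Rightarrow> nat \<Rightarrow> 'b" where
  "scatter p D ad v f c =
     (if \<exists>i<p. D i \<and> ad i = c then v (THE i. i < p \<and> D i \<and> ad i = c) else f c)"

lemma scatter_hit:
  assumes "inj_on ad {i. i < p \<and> D i}" "i < p" "D i" "ad i = c"
  shows "scatter p D ad v f c = v i"
proof -
  have "(THE i. i < p \<and> D i \<and> ad i = c) = i"
    using assms by (intro the_equality) (auto simp: inj_on_def)
  then show ?thesis using assms by (auto simp: scatter_def)
qed

lemma scatter_miss: "(\<And>i. i < p \<Longrightarrow> D i \<Longrightarrow> ad i \<noteq> c) \<Longrightarrow> scatter p D ad v f c = f c"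
  by (auto simp: scatter_def)

section \<open>One synchronous step of all processors\<close>

lemma step_quiet:
  assumes rep: "rep p c (M, s, r) C" and p: "0 < p"
    and ls: "\<And>i. i < p \<Longrightarrow> c i \<noteq> [] \<and> local_step M i (c i, s i, r i) = ((c' i, s' i, r' i), Silent)"
  shows "steps C p 1 (step C)" "rep p c' (M, s', r') (step C)"
proof -
  have act: "active C = {..<p}" using active_rep[OF rep] ls by blast
  have e: "eff C i = Silent" for i
    using ls[of i] by (cases "i < p") (simp_all add: idle_rep[OF rep] busy_rep[OF rep])
  have s: "succ C i = (if i < p then (c' i, s' i, r' i) else snd C i)" for i
    using ls[of i] by (cases "i < p") (simp_all add: idle_rep[OF rep] busy_rep[OF rep])
  have "exclusive_write C" by (simp add: exclusive_write_def e)
  then have "steps C (card (active C) + 0) (Suc 0) (step C)"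
    using act p by (intro steps.intros) auto
  then show "steps C p 1 (step C)" by (simp add: act)
  show "rep p c' (M, s', r') (step C)"
    using rep by (auto simp: step_def e s rep_def)
qed

lemma step_nwrite:
  assumes rep: "rep p c (M, s, r) C" and p: "0 < p"
    and ls: "\<And>i. i < p \<Longrightarrow> c i \<noteq> [] \<and> local_step M i (c i, s i, r i) =
      ((c' i, s' i, r' i), if D i then WriteN a (ad i) (v i) else Silent)"
    and inj: "inj_on ad {i. i < p \<and> D i}"
  shows "steps C p 1 (step C)"
    "rep p c' (M\<lparr>nmem := (nmem M)(a := scatter p D ad v (nmem M a))\<rparr>, s', r') (step C)"
proof -
  have act: "active C = {..<p}" using active_rep[OF rep] ls by blast
  have e: "eff C i = (if i < p \<and> D i then WriteN a (ad i) (v i) else Silent)" for i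
    using ls[of i] by (cases "i < p") (simp_all add: idle_rep[OF rep] busy_rep[OF rep])
  have s: "succ C i = (if i < p then (c' i, s' i, r' i) else snd C i)" for i
    using ls[of i] by (cases "i < p") (simp_all add: idle_rep[OF rep] busy_rep[OF rep])
  have "exclusive_write C" using inj by (auto simp: exclusive_write_def e inj_on_def)
  then have "steps C (card (active C) + 0) (Suc 0) (step C)"
    using act p by (intro steps.intros) auto
  then show "steps C p 1 (step C)" by (simp add: act)
  have wr: "(\<exists>i w. eff C i = WriteN b k w) \<longleftrightarrow> b = a \<and> (\<exists>i<p. D i \<and> ad i = k)" for b k
    by (auto simp: e)
  have the: "(THE w. \<exists>i. eff C i = WriteN a k w) = v (THE i. i < p \<and> D i \<and> ad i = k)"
    if "i < p" "D i" "ad i = k" for i k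
  proof -
    have "(THE i. i < p \<and> D i \<and> ad i = k) = i"
      using that inj by (intro the_equality) (auto simp: inj_on_def)
    moreover have "(THE w. \<exists>i. eff C i = WriteN a k w) = v i"
      using that inj by (intro the_equality) (auto simp: e inj_on_def split: if_splits)
    ultimately show ?thesis by simp
  qed
  have M: "fst C = M" using rep by (simp add: rep_def)
  have "nmem (fst (step C)) = (nmem M)(a := scatter p D ad v (nmem M a))"
    unfolding step_def fst_conv memory.simps wr M
    by (auto simp: fun_eq_iff scatter_def the)
  moreover have "\<not> (\<exists>i w. eff C i = WriteR b k w)" for b k by (auto simp: e)
  then have "rmem (fst (step C)) = rmem M" by (simp add: step_def M)
  ultimately have "fst (step C) = M\<lparr>nmem := (nmem M)(a := scatter p D ad v (nmem M a))\<rparr>"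
    by simp
  then show "rep p c' (M\<lparr>nmem := (nmem M)(a := scatter p D ad v (nmem M a))\<rparr>, s', r') (step C)"
    using rep by (auto simp: step_def e s rep_def)
qed

lemma step_rwrite:
  assumes rep: "rep p c (M, s, r) C" and p: "0 < p"
    and ls: "\<And>i. i < p \<Longrightarrow> c i \<noteq> [] \<and> local_step M i (c i, s i, r i) =
      ((c' i, s' i, r' i), if D i then WriteR a (ad i) (v i) else Silent)"
    and inj: "inj_on ad {i. i < p \<and> D i}"
  shows "steps C p 1 (step C)"
    "rep p c' (M\<lparr>rmem := (rmem M)(a := scatter p D ad v (rmem M a))\<rparr>, s', r') (step C)"
proof -
  have act: "active C = {..<p}" using active_rep[OF rep] ls by blast
  have e: "eff C i = (if i < p \<and> D i then WriteR a (ad i) (v i) else Silent)" for i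
    using ls[of i] by (cases "i < p") (simp_all add: idle_rep[OF rep] busy_rep[OF rep])
  have s: "succ C i = (if i < p then (c' i, s' i, r' i) else snd C i)" for i
    using ls[of i] by (cases "i < p") (simp_all add: idle_rep[OF rep] busy_rep[OF rep])
  have "exclusive_write C" using inj by (auto simp: exclusive_write_def e inj_on_def)
  then have "steps C (card (active C) + 0) (Suc 0) (step C)"
    using act p by (intro steps.intros) auto
  then show "steps C p 1 (step C)" by (simp add: act)
  have wr: "(\<exists>i w. eff C i = WriteR b k w) \<longleftrightarrow> b = a \<and> (\<exists>i<p. D i \<and> ad i = k)" for b k
    by (auto simp: e)
  have the: "(THE w. \<exists>i. eff C i = WriteR a k w) = v (THE i. i < p \<and> D i \<and> ad i = k)"
    if "i < p" "D i" "ad i = k" for i k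
  proof -
    have "(THE i. i < p \<and> D i \<and> ad i = k) = i"
      using that inj by (intro the_equality) (auto simp: inj_on_def)
    moreover have "(THE w. \<exists>i. eff C i = WriteR a k w) = v i"
      using that inj by (intro the_equality) (auto simp: e inj_on_def split: if_splits)
    ultimately show ?thesis by simp
  qed
  have M: "fst C = M" using rep by (simp add: rep_def)
  have "rmem (fst (step C)) = (rmem M)(a := scatter p D ad v (rmem M a))"
    unfolding step_def fst_conv memory.simps wr M
    by (auto simp: fun_eq_iff scatter_def the)
  moreover have "\<not> (\<exists>i w. eff C i = WriteN b k w)" for b k by (auto simp: e)
  then have "nmem (fst (step C)) = nmem M" by (simp add: step_def M)
  ultimately have "fst (step C) = M\<lparr>rmem := (rmem M)(a := scatter p D ad v (rmem M a))\<rparr>"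
    by simp
  then show "rep p c' (M\<lparr>rmem := (rmem M)(a := scatter p D ad v (rmem M a))\<rparr>, s', r') (step C)"
    using rep by (auto simp: step_def e s rep_def)
qed

text \<open>The activated numbers \<open>i + p\<close> are distinct and all idle, so the step is
  conflict-free. A new processor starts as a copy of its activator, whence the index
  \<open>i - p\<close>.\<close>

lemma step_fork:
  assumes rep: "rep p (\<lambda>_. Fork y # c) (M, s, r) C" and p: "0 < p"
    and y: "\<And>i. i < p \<Longrightarrow> s i y = i + p"
  shows "steps C p 1 (step C)"
    "rep (p + p) (\<lambda>_. c) (M, \<lambda>i. s (if i < p then i else i - p), \<lambda>i. r (if i < p then i else i - p)) (step C)"
proof -
  have act: "active C = {..<p}" using active_rep[OF rep] by blast
  have e: "eff C i = (if i < p then Activate (i + p) else Silent)" for i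
    using y[of i] by (cases "i < p") (simp_all add: idle_rep[OF rep] busy_rep[OF rep])
  have s: "succ C i = (if i < p then (c, s i, r i) else snd C i)" for i
    by (cases "i < p") (simp_all add: idle_rep[OF rep] busy_rep[OF rep])
  have "exclusive_write C" by (auto simp: exclusive_write_def e act split: if_splits)
  then have "steps C (card (active C) + 0) (Suc 0) (step C)"
    using act p by (intro steps.intros) auto
  then show "steps C p 1 (step C)" by (simp add: act)
  have ex: "(\<exists>i. eff C i = Activate j) \<longleftrightarrow> p \<le> j \<and> j < p + p" for j
    by (auto simp: e intro!: exI[of _ "j - p"])
  have the: "(THE i. eff C i = Activate j) = j - p" if "p \<le> j" "j < p + p" for j
    using that by (intro the_equality) (auto simp: e split: if_splits)
  show "rep (p + p) (\<lambda>_. c) (M, \<lambda>i. s (if i < p then i else i - p), \<lambda>i. r (if i < p then i else i - p)) (step C)"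
    using rep by (auto simp: step_def ex the s rep_def) (auto simp: e)
qed

text \<open>
  All \<open>p\<close> active processors have the same code \<open>c\<close> left, at the end of which there are
  \<open>p'\<close> of them, again in lockstep. The bounds on the work compose under sequencing.
\<close>

definition wp :: "nat \<Rightarrow> stmt list \<Rightarrow> nat \<Rightarrow> nat \<Rightarrow> (state \<Rightarrow> bool) \<Rightarrow> state \<Rightarrow> bool" where
  "wp p c p' T Q S \<longleftrightarrow> (0 < p \<longrightarrow> p \<le> p' \<and> (\<forall>k C. rep p (\<lambda>_. c @ k) S C \<longrightarrow>
     (\<exists>C' S' wk. Q S' \<and> rep p' (\<lambda>_. k) S' C' \<and> steps C wk T C' \<and> p * T \<le> wk \<and> wk \<le> p' * T)))"

lemma wp_mono: "wp p c p' T Q S \<Longrightarrow> (\<And>S. Q S \<Longrightarrow> Q' S) \<Longrightarrow> wp p c p' T Q' S"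
  unfolding wp_def by blast

lemma wp_Nil: "Q S \<Longrightarrow> wp p [] p 0 Q S"
  unfolding wp_def using steps_refl by fastforce

lemma wp_append:
  assumes "wp p c p' T (wp p' c' p'' T' Q) S"
  shows "wp p (c @ c') p'' (T + T') Q S"
  unfolding wp_def
proof (intro impI conjI allI)
  assume p: "0 < p"
  then have p': "p \<le> p'" using assms by (simp add: wp_def)
  have ex: "\<exists>S'. wp p' c' p'' T' Q S'" if "rep p (\<lambda>_. (c @ c') @ k) S C" for k C
    using assms p that unfolding wp_def[of p] by (metis append.assoc)
  {
    fix k C assume r: "rep p (\<lambda>_. (c @ c') @ k) S C"
    then obtain C1 S1 wk1 where 1: "wp p' c' p'' T' Q S1" "rep p' (\<lambda>_. c' @ k) S1 C1"
        "steps C wk1 T C1" "p * T \<le> wk1" "wk1 \<le> p' * T"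
      using assms p unfolding wp_def[of p] append.assoc by blast
    then obtain C2 S2 wk2 where 2: "Q S2" "rep p'' (\<lambda>_. k) S2 C2"
        "steps C1 wk2 T' C2" "p' * T' \<le> wk2" "wk2 \<le> p'' * T'" "p' \<le> p''"
      using p p' unfolding wp_def by (metis less_le_trans)
    have "p * T' \<le> p' * T'" "p' * T \<le> p'' * T" using p' 2(6) by auto
    then have "p * (T + T') \<le> wk1 + wk2" "wk1 + wk2 \<le> p'' * (T + T')"
      using 1 2 unfolding add_mult_distrib2 by linarith+
    then show "\<exists>C' S' wk. Q S' \<and> rep p'' (\<lambda>_. k) S' C' \<and> steps C wk (T + T') C' \<and>
      p * (T + T') \<le> wk \<and> wk \<le> p'' * (T + T')"
      using 1 2 steps_trans by blast
  }
  \<comment> \<open>The second \<open>wp\<close> is only available at a state reached from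
    \<open>S\<close>, so some configuration representing \<open>S\<close> has to be exhibited before
    its bound on processor counts can be used.\<close>
  obtain M s r where S: "S = (M, s, r)" by (cases S)
  have "rep p (\<lambda>_. (c @ c') @ []) S (M, \<lambda>i. (if i < p then c @ c' else [], s i, r i))"
    by (simp add: rep_def S)
  from ex[OF this] show "p \<le> p''" using p p' unfolding wp_def by force
qed

lemma wp_Cons: "wp p [c] p' T (wp p' cs p'' T' Q) S \<Longrightarrow> wp p (c # cs) p'' (T + T') Q S"
  using wp_append[of p "[c]"] by simp

lemma wp_quiet:
  assumes "\<And>i k. i < p \<Longrightarrow> local_step M i (c # k, s i, r i) = ((k, s' i, r' i), Silent)"
    and "Q (M, s', r')"
  shows "wp p [c] p 1 Q (M, s, r)"
  unfolding wp_def
proof (intro impI conjI allI)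
  fix k C assume p: "0 < p" and "rep p (\<lambda>_. [c] @ k) (M, s, r) C"
  then have rep: "rep p (\<lambda>_. c # k) (M, s, r) C" by simp
  from step_quiet[OF this p, of "\<lambda>_. k" s' r'] assms
  show "\<exists>C' S' wk. Q S' \<and> rep p (\<lambda>_. k) S' C' \<and> steps C wk 1 C' \<and> p * 1 \<le> wk \<and> wk \<le> p * 1"
    by (intro exI[of _ "step C"] exI[of _ "(M, s', r')"] exI[of _ p]) auto
qed simp

text \<open>Meaningful only for straight-line code in which both arms of every branch consist of one instruction.\<close>

fun cost :: "stmt list \<Rightarrow> nat" where
  "cost [] = 0"
| "cost (Branch _ _ _ # cs) = 2 + cost cs"
| "cost (c # cs) = 1 + cost cs"

text \<open>
  In the rules below, the new registers and memory are constrained by equations instead of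
  being written out: otherwise the terms would grow exponentially with the length of the code.
\<close>

definition wps :: "nat \<Rightarrow> stmt list \<Rightarrow> (state \<Rightarrow> bool) \<Rightarrow> state \<Rightarrow> bool" where
  "wps p cs Q S = wp p cs p (cost cs) Q S"

lemma wps_Nil: "Q S \<Longrightarrow> wps p [] Q S"
  by (simp add: wps_def wp_Nil)

lemma wps_quiet:
  assumes "\<And>i k. i < p \<Longrightarrow> local_step M i (c # k, s i, r i) = ((k, s' i, r' i), Silent)"
    and "wps p cs Q (M, s', r')" and "cost (c # cs) = 1 + cost cs"
  shows "wps p (c # cs) Q (M, s, r)"
  using assms unfolding wps_def by (metis wp_quiet wp_Cons)

lemma wps_NConst:
  assumes "\<And>s'. (\<And>i x'. s' i x' = (if x' = x then c else s i x')) \<Longrightarrow> wps p cs Q (M, s', r)"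
  shows "wps p (NConst x c # cs) Q (M, s, r)"
  by (rule wps_quiet[OF _ assms], simp, simp, simp)

lemma wps_NAdd:
  assumes "\<And>s'. (\<And>i x'. s' i x' = (if x' = x then s i y + s i z else s i x')) \<Longrightarrow> wps p cs Q (M, s', r)"
  shows "wps p (NAdd x y z # cs) Q (M, s, r)"
  by (rule wps_quiet[OF _ assms], simp, simp, simp)

lemma wps_NSub:
  assumes "\<And>s'. (\<And>i x'. s' i x' = (if x' = x then s i y - s i z else s i x')) \<Longrightarrow> wps p cs Q (M, s', r)"
  shows "wps p (NSub x y z # cs) Q (M, s, r)"
  by (rule wps_quiet[OF _ assms], simp, simp, simp)

lemma wps_NHalf:
  assumes "\<And>s'. (\<And>i x'. s' i x' = (if x' = x then s i y div 2 else s i x')) \<Longrightarrow> wps p cs Q (M, s', r)"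
  shows "wps p (NHalf x y # cs) Q (M, s, r)"
  by (rule wps_quiet[OF _ assms], simp, simp, simp)

lemma wps_Pid:
  assumes "\<And>s'. (\<And>i x'. s' i x' = (if x' = x then i else s i x')) \<Longrightarrow> wps p cs Q (M, s', r)"
  shows "wps p (Pid x # cs) Q (M, s, r)"
  by (rule wps_quiet[OF _ assms], simp, simp, simp)

lemma wps_NLoad:
  assumes "\<And>s'. (\<And>i x'. s' i x' = (if x' = x then nmem M a (s i y) else s i x')) \<Longrightarrow> wps p cs Q (M, s', r)"
  shows "wps p (NLoad x a y # cs) Q (M, s, r)"
  by (rule wps_quiet[OF _ assms], simp, simp, simp)

lemma wps_RCast:
  assumes "\<And>r'. (\<And>i x'. r' i x' = (if x' = x then real (s i y) else r i x')) \<Longrightarrow> wps p cs Q (M, s, r')"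
  shows "wps p (RCast x y # cs) Q (M, s, r)"
  by (rule wps_quiet[OF _ assms], simp, simp, simp)

lemma wps_RAdd:
  assumes "\<And>r'. (\<And>i x'. r' i x' = (if x' = x then r i y + r i z else r i x')) \<Longrightarrow> wps p cs Q (M, s, r')"
  shows "wps p (RAdd x y z # cs) Q (M, s, r)"
  by (rule wps_quiet[OF _ assms], simp, simp, simp)

lemma wps_RSub:
  assumes "\<And>r'. (\<And>i x'. r' i x' = (if x' = x then r i y - r i z else r i x')) \<Longrightarrow> wps p cs Q (M, s, r')"
  shows "wps p (RSub x y z # cs) Q (M, s, r)"
  by (rule wps_quiet[OF _ assms], simp, simp, simp)

lemma wps_RMul:
  assumes "\<And>r'. (\<And>i x'. r' i x' = (if x' = x then r i y * r i z else r i x')) \<Longrightarrow> wps p cs Q (M, s, r')"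
  shows "wps p (RMul x y z # cs) Q (M, s, r)"
  by (rule wps_quiet[OF _ assms], simp, simp, simp)

lemma wps_RDiv:
  assumes "\<And>r'. (\<And>i x'. r' i x' = (if x' = x then r i y / r i z else r i x')) \<Longrightarrow> wps p cs Q (M, s, r')"
  shows "wps p (RDiv x y z # cs) Q (M, s, r)"
  by (rule wps_quiet[OF _ assms], simp, simp, simp)

lemma wps_RLoad:
  assumes "\<And>r'. (\<And>i x'. r' i x' = (if x' = x then rmem M a (s i y) else r i x')) \<Longrightarrow> wps p cs Q (M, s, r')"
  shows "wps p (RLoad x a y # cs) Q (M, s, r)"
  by (rule wps_quiet[OF _ assms], simp, simp, simp)

text \<open>Processors hold different code only between the test and the chosen arm. Since both arms
  are single instructions, the codes agree again after two steps.\<close>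

lemma wp_branch:
  assumes sel: "\<And>i. i < p \<Longrightarrow> holds c (s i) (r i) \<longleftrightarrow> D i"
    and run: "\<And>k C. rep p (\<lambda>i. (if D i then x else y) # k) (M, s, r) C \<Longrightarrow> 0 < p \<Longrightarrow>
       steps C p 1 (step C) \<and> rep p (\<lambda>_. k) S' (step C)"
    and cont: "wps p cs Q S'"
  shows "wps p (Branch c [x] [y] # cs) Q (M, s, r)"
proof -
  have "wp p [Branch c [x] [y]] p 2 (wps p cs Q) (M, s, r)"
    unfolding wp_def
  proof (intro impI conjI allI)
    fix k C assume p: "0 < p" and "rep p (\<lambda>_. [Branch c [x] [y]] @ k) (M, s, r) C"
    then have rep: "rep p (\<lambda>_. Branch c [x] [y] # k) (M, s, r) C" by simp
    have "steps C p 1 (step C)" "rep p (\<lambda>i. (if D i then x else y) # k) (M, s, r) (step C)"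
      by (rule step_quiet[OF rep p]; simp add: sel)+
    moreover from run[OF this(2) p]
    have "steps (step C) p 1 (step (step C))" "rep p (\<lambda>_. k) S' (step (step C))" by auto
    ultimately show "\<exists>C' S' wk. wps p cs Q S' \<and> rep p (\<lambda>_. k) S' C' \<and> steps C wk 2 C' \<and> p * 2 \<le> wk \<and> wk \<le> p * 2"
      using cont steps_trans[of C p 1 "step C" p 1] 
      by (intro exI[of _ "step (step C)"] exI[of _ S'] exI[of _ "p + p"])  (auto simp: numeral_2_eq_2)
  qed simp
  from wp_Cons[OF this[unfolded wps_def]] show ?thesis by (simp add: wps_def)
qed

definition cmp :: "nat \<Rightarrow> nat \<Rightarrow> nat \<Rightarrow> stmt" where
  "cmp f x y = Branch (RLess x y) [NConst f 1] [NConst f 0]"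

text \<open>Register 0 holds 0; register 30 is never read.\<close>

definition guarded :: "nat \<Rightarrow> stmt \<Rightarrow> stmt" where
  "guarded f c = Branch (NLess 0 f) [c] [NConst 30 0]"

lemma cost_macros [simp]:
  "cost (cmp f x y # cs) = 2 + cost cs"
  "cost (guarded f c # cs) = 2 + cost cs"
  by (simp_all add: cmp_def guarded_def)

lemma wps_cmp:
  assumes "\<And>s'. (\<And>i x'. s' i x' = (if x' = f then of_bool (r i x < r i y) else s i x')) \<Longrightarrow>
    wps p cs Q (M, s', r)"
  shows "wps p (cmp f x y # cs) Q (M, s, r)"
  unfolding cmp_def
proof (rule wp_branch[where D="\<lambda>i. r i x < r i y", OF _ _ assms])
  fix k C
  assume *: "rep p (\<lambda>i. (if r i x < r i y then NConst f 1 else NConst f 0) # k) (M, s, r) C" "0 < p"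
  show "steps C p 1 (step C) \<and>
    rep p (\<lambda>_. k) (M, \<lambda>i. (s i)(f := of_bool (r i x < r i y)), r) (step C)"
    by (rule conjI; rule step_quiet[OF *, where c'="\<lambda>_. k" and r'=r
      and s'="\<lambda>i. (s i)(f := of_bool (r i x < r i y))"]) simp_all
qed simp_all

lemma wps_guarded_NAdd:
  assumes cont: "\<And>s'. (\<And>i x'. x' \<noteq> 30 \<Longrightarrow> s' i x' = (if x' = x \<and> 0 < s i f then s i y + s i z else s i x')) \<Longrightarrow>
      wps p cs Q (M, s', r)"
    and zero: "\<And>i. i < p \<Longrightarrow> s i 0 = 0"
  shows "wps p (guarded f (NAdd x y z) # cs) Q (M, s, r)"
  unfolding guarded_def
proof (rule wp_branch[where D="\<lambda>i. 0 < s i f", OF _ _ cont])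
  fix k C
  assume *: "rep p (\<lambda>i. (if 0 < s i f then NAdd x y z else NConst 30 0) # k) (M, s, r) C" "0 < p"
  show "steps C p 1 (step C) \<and>
    rep p (\<lambda>_. k) (M, \<lambda>i. if 0 < s i f then (s i)(x := s i y + s i z) else (s i)(30 := 0), r) (step C)"
    by (rule conjI; rule step_quiet[OF *, where c'="\<lambda>_. k" and r'=r
      and s'="\<lambda>i. if 0 < s i f then (s i)(x := s i y + s i z) else (s i)(30 := 0)"]) simp_all
qed (simp_all add: zero)

lemma wps_guarded_NStore:
  assumes cont: "\<And>M' s'.
      (\<And>b. nmem M' b = (if b = a then scatter p (\<lambda>i. 0 < s i f) (\<lambda>i. s i y) (\<lambda>i. s i x) (nmem M a)
        else nmem M b)) \<Longrightarrow>
      rmem M' = rmem M \<Longrightarrow>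
      (\<And>i x'. x' \<noteq> 30 \<Longrightarrow> s' i x' = s i x') \<Longrightarrow> wps p cs Q (M', s', r)"
    and zero: "\<And>i. i < p \<Longrightarrow> s i 0 = 0"
    and inj: "inj_on (\<lambda>i. s i y) {i. i < p \<and> 0 < s i f}"
  shows "wps p (guarded f (NStore a y x) # cs) Q (M, s, r)"
  unfolding guarded_def
proof (rule wp_branch[where D="\<lambda>i. 0 < s i f", OF _ _ cont])
  fix k C
  assume *: "rep p (\<lambda>i. (if 0 < s i f then NStore a y x else NConst 30 0) # k) (M, s, r) C" "0 < p"
  show "steps C p 1 (step C) \<and>
    rep p (\<lambda>_. k) (M\<lparr>nmem := (nmem M)(a := scatter p (\<lambda>i. 0 < s i f) (\<lambda>i. s i y) (\<lambda>i. s i x) (nmem M a))\<rparr>,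
      \<lambda>i. if 0 < s i f then s i else (s i)(30 := 0), r) (step C)"
    by (rule conjI; rule step_nwrite[OF * _ inj, where c'="\<lambda>_. k" and r'=r
      and s'="\<lambda>i. if 0 < s i f then s i else (s i)(30 := 0)" and v="\<lambda>i. s i x" and a=a]) simp_all
qed (simp_all add: zero)

lemma wps_guarded_RStore:
  assumes cont: "\<And>M' s'.
      (\<And>b. rmem M' b = (if b = a then scatter p (\<lambda>i. 0 < s i f) (\<lambda>i. s i y) (\<lambda>i. r i x) (rmem M a)
        else rmem M b)) \<Longrightarrow>
      nmem M' = nmem M \<Longrightarrow>
      (\<And>i x'. x' \<noteq> 30 \<Longrightarrow> s' i x' = s i x') \<Longrightarrow> wps p cs Q (M', s', r)"
    and zero: "\<And>i. i < p \<Longrightarrow> s i 0 = 0"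
    and inj: "inj_on (\<lambda>i. s i y) {i. i < p \<and> 0 < s i f}"
  shows "wps p (guarded f (RStore a y x) # cs) Q (M, s, r)"
  unfolding guarded_def
proof (rule wp_branch[where D="\<lambda>i. 0 < s i f", OF _ _ cont])
  fix k C
  assume *: "rep p (\<lambda>i. (if 0 < s i f then RStore a y x else NConst 30 0) # k) (M, s, r) C" "0 < p"
  show "steps C p 1 (step C) \<and>
    rep p (\<lambda>_. k) (M\<lparr>rmem := (rmem M)(a := scatter p (\<lambda>i. 0 < s i f) (\<lambda>i. s i y) (\<lambda>i. r i x) (rmem M a))\<rparr>,
      \<lambda>i. if 0 < s i f then s i else (s i)(30 := 0), r) (step C)"
    by (rule conjI; rule step_rwrite[OF * _ inj, where c'="\<lambda>_. k" and r'=r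
      and s'="\<lambda>i. if 0 < s i f then s i else (s i)(30 := 0)" and v="\<lambda>i. r i x" and a=a]) simp_all
qed (simp_all add: zero)

lemma wps_NStore:
  assumes cont: "\<And>M'.
      (\<And>b. nmem M' b = (if b = a then scatter p (\<lambda>i. True) (\<lambda>i. s i y) (\<lambda>i. s i x) (nmem M a)
        else nmem M b)) \<Longrightarrow>
      rmem M' = rmem M \<Longrightarrow> wps p cs Q (M', s, r)"
    and inj: "inj_on (\<lambda>i. s i y) {i. i < p}"
  shows "wps p (NStore a y x # cs) Q (M, s, r)"
proof -
  let ?S = "(M\<lparr>nmem := (nmem M)(a := scatter p (\<lambda>_. True) (\<lambda>i. s i y) (\<lambda>i. s i x) (nmem M a))\<rparr>, s, r)"
  have "wp p [NStore a y x] p 1 (wps p cs Q) (M, s, r)"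
    unfolding wp_def
  proof (intro impI conjI allI)
    fix k C assume p: "0 < p" and "rep p (\<lambda>_. [NStore a y x] @ k) (M, s, r) C"
    then have rep: "rep p (\<lambda>_. NStore a y x # k) (M, s, r) C" by simp
    have inj': "inj_on (\<lambda>i. s i y) {i. i < p \<and> True}" using inj by simp
    have "steps C p 1 (step C)" "rep p (\<lambda>_. k) ?S (step C)"
      by (rule step_nwrite[OF rep p _ inj', where c'="\<lambda>_. k" and r'=r and s'=s and v="\<lambda>i. s i x" and a=a]; simp)+
    moreover have "wps p cs Q ?S" by (rule cont) simp_all
    ultimately show "\<exists>C' S' wk. wps p cs Q S' \<and> rep p (\<lambda>_. k) S' C' \<and> steps C wk 1 C' \<and> p * 1 \<le> wk \<and> wk \<le> p * 1"
      by (intro exI[of _ "step C"] exI[of _ ?S] exI[of _ p]) auto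
  qed simp
  from wp_Cons[OF this[unfolded wps_def]] show ?thesis by (simp add: wps_def)
qed

lemma wps_RStore:
  assumes cont: "\<And>M'.
      (\<And>b. rmem M' b = (if b = a then scatter p (\<lambda>i. True) (\<lambda>i. s i y) (\<lambda>i. r i x) (rmem M a)
        else rmem M b)) \<Longrightarrow>
      nmem M' = nmem M \<Longrightarrow> wps p cs Q (M', s, r)"
    and inj: "inj_on (\<lambda>i. s i y) {i. i < p}"
  shows "wps p (RStore a y x # cs) Q (M, s, r)"
proof -
  let ?S = "(M\<lparr>rmem := (rmem M)(a := scatter p (\<lambda>_. True) (\<lambda>i. s i y) (\<lambda>i. r i x) (rmem M a))\<rparr>, s, r)"
  have "wp p [RStore a y x] p 1 (wps p cs Q) (M, s, r)"
    unfolding wp_def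
  proof (intro impI conjI allI)
    fix k C assume p: "0 < p" and "rep p (\<lambda>_. [RStore a y x] @ k) (M, s, r) C"
    then have rep: "rep p (\<lambda>_. RStore a y x # k) (M, s, r) C" by simp
    have inj': "inj_on (\<lambda>i. s i y) {i. i < p \<and> True}" using inj by simp
    have "steps C p 1 (step C)" "rep p (\<lambda>_. k) ?S (step C)"
      by (rule step_rwrite[OF rep p _ inj', where c'="\<lambda>_. k" and r'=r and s'=s and v="\<lambda>i. r i x" and a=a]; simp)+
    moreover have "wps p cs Q ?S" by (rule cont) simp_all
    ultimately show "\<exists>C' S' wk. wps p cs Q S' \<and> rep p (\<lambda>_. k) S' C' \<and> steps C wk 1 C' \<and> p * 1 \<le> wk \<and> wk \<le> p * 1"
      by (intro exI[of _ "step C"] exI[of _ ?S] exI[of _ p]) auto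
  qed simp
  from wp_Cons[OF this[unfolded wps_def]] show ?thesis by (simp add: wps_def)
qed

lemmas wps_rules = wps_NConst wps_NAdd wps_NSub wps_NHalf wps_Pid wps_RCast wps_RAdd wps_RSub
  wps_RMul wps_RDiv wps_NLoad wps_RLoad wps_NStore wps_RStore
  wps_cmp wps_guarded_NAdd wps_guarded_NStore wps_guarded_RStore wps_Nil

section \<open>Forks and loops\<close>

lemma wp_Fork:
  assumes "\<And>i. i < p \<Longrightarrow> s i y = i + p"
    and "Q (M, \<lambda>i. s (if i < p then i else i - p), \<lambda>i. r (if i < p then i else i - p))"
  shows "wp p [Fork y] (p + p) 1 Q (M, s, r)"
  unfolding wp_def
proof (intro impI conjI allI)
  fix k C assume p: "0 < p" and "rep p (\<lambda>_. [Fork y] @ k) (M, s, r) C"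
  then have rep: "rep p (\<lambda>_. Fork y # k) (M, s, r) C" by simp
  from step_fork[OF this p assms(1)] assms(2)
  show "\<exists>C' S' wk. Q S' \<and> rep (p + p) (\<lambda>_. k) S' C' \<and> steps C wk 1 C' \<and> p * 1 \<le> wk \<and> wk \<le> (p + p) * 1"
    by (intro exI[of _ "step C"] exI exI[of _ p]) auto
qed simp

lemma wp_loop_test:
  assumes "\<And>i. i < p \<Longrightarrow> holds c (s i) (r i) \<longleftrightarrow> b"
    and "if b then wp p (body @ [Loop c body]) p' T Q (M, s, r) else p' = p \<and> T = 0 \<and> Q (M, s, r)"
  shows "wp p [Loop c body] p' (Suc T) Q (M, s, r)"
  unfolding wp_def
proof (intro impI conjI allI)
  assume p: "0 < p"
  then show "p \<le> p'" using assms(2) by (auto simp: wp_def split: if_splits)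
  fix k C assume "rep p (\<lambda>_. [Loop c body] @ k) (M, s, r) C"
  then have rep: "rep p (\<lambda>_. Loop c body # k) (M, s, r) C" by simp
  have st: "steps C p 1 (step C)"
      "rep p (\<lambda>_. if b then body @ Loop c body # k else k) (M, s, r) (step C)"
    by (rule step_quiet[OF rep p]; simp add: assms(1))+
  show "\<exists>C' S' wk. Q S' \<and> rep p' (\<lambda>_. k) S' C' \<and> steps C wk (Suc T) C' \<and> p * Suc T \<le> wk \<and> wk \<le> p' * Suc T"
  proof (cases b)
    case True
    then have w: "wp p (body @ [Loop c body]) p' T Q (M, s, r)"
      and rp: "rep p (\<lambda>_. (body @ [Loop c body]) @ k) (M, s, r) (step C)" using assms(2) st by auto
    from w p rp obtain C' S' wk where "Q S'" "rep p' (\<lambda>_. k) S' C'" "steps (step C) wk T C'"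
      "p * T \<le> wk" "wk \<le> p' * T" "p \<le> p'"
      unfolding wp_def by blast
    then show ?thesis using steps_trans[OF st(1)]
      by (intro exI[of _ C'] exI[of _ S'] exI[of _ "p + wk"]) auto
  next
    case False
    then show ?thesis using assms(2) st
      by (intro exI[of _ "step C"] exI[of _ "(M, s, r)"] exI[of _ "p"]) auto
  qed
qed

text \<open>The processor count \<open>q t\<close> may change from round to round, as the forking
  loop requires. There are \<open>m\<close> bodies and \<open>m + 1\<close> tests. The induction is
  on the number of remaining rounds, because a loop unfolds at its front.\<close>

lemma wp_Loop:
  assumes tru: "\<And>t M s r i. t < m \<Longrightarrow> I t (M, s, r) \<Longrightarrow> i < q t \<Longrightarrow> holds c (s i) (r i)"
    and fls: "\<And>M s r i. I m (M, s, r) \<Longrightarrow> i < q m \<Longrightarrow> \<not> holds c (s i) (r i)"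
    and body: "\<And>t M s r. t < m \<Longrightarrow> I t (M, s, r) \<Longrightarrow> wp (q t) body (q (Suc t)) T (I (Suc t)) (M, s, r)"
    and init: "I 0 S"
  shows "wp (q 0) [Loop c body] (q m) (m * (T + 1) + 1) (I m) S"
proof -
  have "t \<le> m \<Longrightarrow> I (m - t) S \<Longrightarrow> wp (q (m - t)) [Loop c body] (q m) (t * (T + 1) + 1) (I m) S" for t S
  proof (induction t arbitrary: S)
    case 0
    obtain M s r where S: "S = (M, s, r)" by (cases S)
    show ?case using wp_loop_test[where b=False and p'="q m" and T=0] 0 fls unfolding S by auto
  next
    case (Suc t)
    obtain M s r where S: "S = (M, s, r)" by (cases S)
    have e: "Suc (m - Suc t) = m - t" using Suc.prems by simp
    have "wp (q (m - Suc t)) (body @ [Loop c body]) (q m) (T + (t * (T + 1) + 1)) (I m) (M, s, r)"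
      by (rule wp_append, rule wp_mono[OF body[of "m - Suc t" M s r, unfolded e]])
        (use Suc S in auto)
    with wp_loop_test[where b=True and p="q (m - Suc t)" and p'="q m"] show ?case
      using Suc.prems tru[of "m - Suc t" M s r] unfolding S by (auto simp: algebra_simps)
  qed
  from this[of m S] init show ?thesis by simp
qed

lemma wps_Loop:
  assumes "\<And>t M s r i. t < m \<Longrightarrow> I t (M, s, r) \<Longrightarrow> i < p \<Longrightarrow> holds c (s i) (r i)"
    and "\<And>M s r i. I m (M, s, r) \<Longrightarrow> i < p \<Longrightarrow> \<not> holds c (s i) (r i)"
    and "\<And>t M s r. t < m \<Longrightarrow> I t (M, s, r) \<Longrightarrow> wps p body (I (Suc t)) (M, s, r)"
    and "I 0 S"
  shows "wp p [Loop c body] p (m * (cost body + 1) + 1) (I m) S"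
  using wp_Loop[where q="\<lambda>_. p"] assms unfolding wps_def by blast

section \<open>Alias tables from a merge\<close>

text \<open>The test \<open>0 < v i\<close> keeps padding cells, whose weight is 0, from counting as
  light.\<close>

definition deficit :: "real \<Rightarrow> (nat \<Rightarrow> real) \<Rightarrow> nat \<Rightarrow> real" where
  "deficit a v i = (if 0 < v i \<and> \<not> a < v i then a - v i else 0)"

definition surplus :: "real \<Rightarrow> (nat \<Rightarrow> real) \<Rightarrow> nat \<Rightarrow> real" where
  "surplus a v i = (if a < v i then v i - a else 0)"

text \<open>0 if there is no heavy item in \<open>K\<close>.\<close>

definition last_heavy :: "real \<Rightarrow> (nat \<Rightarrow> real) \<Rightarrow> nat set \<Rightarrow> nat" where
  "last_heavy a v K = Max (insert 0 {k \<in> K. a < v k})"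

lemma last_heavy_union:
  "finite K \<Longrightarrow> finite K' \<Longrightarrow> last_heavy a v (K \<union> K') = max (last_heavy a v K) (last_heavy a v K')"
proof -
  assume fin: "finite K" "finite K'"
  have "insert 0 {k \<in> K \<union> K'. a < v k} = insert 0 {k \<in> K. a < v k} \<union> insert 0 {k \<in> K'. a < v k}"
    by auto
  then show ?thesis using fin unfolding last_heavy_def by (simp only:) (rule Max_Un; simp)
qed

lemma last_heavy_empty [simp]: "last_heavy a v {} = 0"
  by (simp add: last_heavy_def)

lemma last_heavy_insert:
  "finite K \<Longrightarrow> last_heavy a v (insert c K) = (if a < v c then max (last_heavy a v K) c else last_heavy a v K)"
proof -
  assume fin: "finite K"
  have "{k \<in> insert c K. a < v k} = (if a < v c then insert c {k \<in> K. a < v k} else {k \<in> K. a < v k})"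
    by auto
  then show ?thesis
    using fin by (auto simp: last_heavy_def insert_commute[of 0] max.commute)
qed

lemma last_heavy_cases:
  assumes "finite K" and "last_heavy a v K \<noteq> 0"
  shows "last_heavy a v K \<in> K" "a < v (last_heavy a v K)"
proof -
  have "last_heavy a v K \<in> insert 0 {k \<in> K. a < v k}"
    unfolding last_heavy_def using assms by (intro Max_in) auto
  then show "last_heavy a v K \<in> K" "a < v (last_heavy a v K)" using assms by auto
qed

lemma last_heavy_ge: "finite K \<Longrightarrow> k \<in> K \<Longrightarrow> a < v k \<Longrightarrow> k \<le> last_heavy a v K"
  unfolding last_heavy_def by (intro Max_ge) auto

section \<open>Prefix sums of deficits and surpluses\<close>

locale weights =
  fixes n :: nat and v :: "nat \<Rightarrow> real"
  assumes n_pos: "1 \<le> n"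
    and v_pos: "i \<in> {1..n} \<Longrightarrow> 0 < v i"
    and v_zero: "i \<notin> {1..n} \<Longrightarrow> v i = 0"
begin

definition avg :: real where "avg = total_weight n v / real n"
definition X :: "nat \<Rightarrow> real" where "X i = (\<Sum>k<i. deficit avg v k)"
definition Y :: "nat \<Rightarrow> real" where "Y j = (\<Sum>k<Suc j. surplus avg v k)"
definition LH :: "nat \<Rightarrow> nat" where "LH j = last_heavy avg v {..<j}"

definition reach :: "real \<Rightarrow> nat" where "reach y = (LEAST i. y \<le> X i)"

lemma total_pos: "0 < total_weight n v"
  unfolding total_weight_def using n_pos v_pos by (intro sum_pos) auto

lemma avg_pos: "0 < avg"
  unfolding avg_def using total_pos n_pos by auto

lemma v_nonneg: "0 \<le> v i" using v_pos[of i] v_zero[of i] by (cases "i \<in> {1..n}") auto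

lemma heavy_in: "avg < v i \<Longrightarrow> i \<in> {1..n}"
  using v_zero avg_pos by force

lemma deficit_nonneg: "0 \<le> deficit avg v i" and surplus_nonneg: "0 \<le> surplus avg v i"
  by (auto simp: deficit_def surplus_def)

lemma X_0 [simp]: "X 0 = 0" by (simp add: X_def)
lemma X_Suc: "X (Suc i) = X i + deficit avg v i" by (simp add: X_def)
lemma Y_Suc: "Y (Suc i) = Y i + surplus avg v (Suc i)" by (simp add: Y_def)
lemma Y_0 [simp]: "Y 0 = 0" using v_zero[of 0] avg_pos by (auto simp: Y_def surplus_def)

lemma mono_X: "mono X" by (intro mono_iff_le_Suc[THEN iffD2]) (simp add: X_Suc deficit_nonneg)
lemma mono_Y: "mono Y" by (intro mono_iff_le_Suc[THEN iffD2]) (simp add: Y_Suc surplus_nonneg)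

lemma X_le: "i \<le> j \<Longrightarrow> X i \<le> X j" using mono_X by (rule monoD)
lemma Y_le: "i \<le> j \<Longrightarrow> Y i \<le> Y j" using mono_Y by (rule monoD)

lemma heavy_iff: "avg < v j \<longleftrightarrow> Y (j - 1) < Y j"
  using v_zero[of 0] avg_pos by (cases j) (auto simp: Y_Suc surplus_def)

lemma light_strict: "X i < X (Suc i) \<Longrightarrow> i \<in> {1..n} \<and> \<not> avg < v i"
  using v_zero[of i] by (auto simp: X_Suc deficit_def split: if_splits)

text \<open>Deviations from the average cancel. The shift by one arises because \<open>X\<close>
  excludes and \<open>Y\<close> includes its own index.\<close>

lemma X_eq_Y_total: "X (Suc n) = Y n"
proof -
  have "{..<Suc n} = insert 0 {1..n}" by auto
  then have s: "(\<Sum>k<Suc n. f k) = (\<Sum>k=1..n. f k)" if "f 0 = 0" for f :: "nat \<Rightarrow> real"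
    using that by simp
  have "Y n - X (Suc n) = (\<Sum>k=1..n. surplus avg v k - deficit avg v k)"
    unfolding Y_def X_def sum_subtractf using v_zero[of 0] avg_pos
    by (subst (1 2) s) (auto simp: surplus_def deficit_def)
  also have "\<dots> = (\<Sum>k=1..n. v k - avg)"
    using v_pos by (intro sum.cong) (auto simp: surplus_def deficit_def)
  also have "\<dots> = 0" using n_pos by (simp add: sum_subtractf avg_def total_weight_def)
  finally show ?thesis by simp
qed

lemma Y_bound: "Y j \<le> X (Suc n)"
proof -
  have "Y (n + k) = Y n" for k
    by (induction k) (use v_zero avg_pos in \<open>auto simp: Y_Suc surplus_def\<close>)
  then have "Y j \<le> Y n" using Y_le[of j n] by (metis le_add_diff_inverse nle_le)
  then show ?thesis by (simp add: X_eq_Y_total)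
qed

lemma X_bound: "X i \<le> X (Suc n)"
proof -
  have "X (Suc n + k) = X (Suc n)" for k
    by (induction k) (use v_zero in \<open>auto simp: X_Suc deficit_def\<close>)
  then show ?thesis using X_le[of i "Suc n"] by (metis le_add_diff_inverse nle_le)
qed

lemma reach_le: "Y j \<le> X (reach (Y j))"
  unfolding reach_def using Y_bound by (rule LeastI)

lemma reach_Suc_n: "reach (Y j) \<le> Suc n"
  unfolding reach_def using Y_bound by (rule Least_le)

lemma below_reach: "i < reach (Y j) \<longleftrightarrow> X i < Y j"
proof
  assume "i < reach (Y j)"
  then show "X i < Y j" unfolding reach_def using not_less_Least by force
next
  assume "X i < Y j"
  then show "i < reach (Y j)" using reach_le[of j] X_le[of "reach (Y j)" i] by force
qed

text \<open>\<open>Y\<close> grows only at heavy items, and none lies strictly between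
  \<open>LH j\<close> and \<open>j\<close>. If no heavy item precedes \<open>j\<close>, the default
  0 still fits because \<open>Y 0 = 0\<close>.\<close>

lemma Y_LH: "Y (LH j) = Y (j - 1)"
proof -
  have "i \<le> j - 1 \<Longrightarrow> LH j \<le> i \<Longrightarrow> Y i = Y (LH j)" for i
  proof (induction i)
    case (Suc i)
    show ?case
    proof (cases "LH j = Suc i")
      case False
      moreover have "Suc i < j" using Suc.prems by simp
      ultimately have "\<not> avg < v (Suc i)"
        using Suc.prems last_heavy_ge[of "{..<j}" "Suc i" avg v] by (auto simp: LH_def)
      then have "Y (Suc i) = Y i" by (simp add: Y_Suc surplus_def)
      then show ?thesis using Suc False by simp
    qed simp
  qed simp
  from this[of "j - 1"] show ?thesis
    using last_heavy_cases(1)[of "{..<j}" avg v] by (cases "LH j = 0") (auto simp: LH_def)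
qed

text \<open>The sampling law reduces to the balance \<open>key\<close>: the weight kept by bucket
  \<open>j\<close> plus the gaps \<open>avg - weight\<close> of all buckets with alias
  \<open>j\<close> must give \<open>v j\<close>. Only heavy items receive nonzero gaps.\<close>

lemma alias_table_criterion:
  assumes w_light: "\<And>j. j \<in> {1..n} \<Longrightarrow> \<not> avg < v j \<Longrightarrow> weight (b j) = v j"
    and w_heavy: "\<And>j. avg < v j \<Longrightarrow> weight (b j) = avg + Y j - X (reach (Y j))"
    and a_light: "\<And>i. X i < X (Suc i) \<Longrightarrow>
      \<exists>j. alias_index (b i) = j \<and> X i < Y j \<and> Y (j - 1) \<le> X i"
    and a_heavy: "\<And>j. avg < v j \<Longrightarrow> LH j \<noteq> 0 \<Longrightarrow> alias_index (b (LH j)) = j"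
    and a_self: "\<And>i. i \<in> {1..n} \<Longrightarrow> X i = X (Suc i) \<Longrightarrow> (\<And>j. avg < v j \<Longrightarrow> LH j \<noteq> i) \<Longrightarrow> alias_index (b i) = i"
  shows "alias_table n v b"
proof -
  let ?W = "total_weight n v"
  have heavy_X: "X (Suc i) = X i" if "avg < v i" for i
    using that by (simp add: X_Suc deficit_def)
  have next_heavy: "avg < v (alias_index (b i)) \<and> LH (alias_index (b i)) = i \<or>
      alias_index (b i) = i \<and> Y i = X (reach (Y i))" if h: "avg < v i" for i
  proof (cases "\<exists>j. avg < v j \<and> LH j = i")
    case True
    then show ?thesis using a_heavy heavy_in[OF h] by auto
  next
    case False
    have "\<not> avg < v j" if "i < j" for j
    proof
      assume "avg < v j"
      \<comment> \<open>The first heavy item after \<open>i\<close> would have \<open>i\<close> as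
        its predecessor.\<close>
      define m where "m = (LEAST j. i < j \<and> avg < v j)"
      have m: "i < m" "avg < v m" unfolding m_def
        by (rule LeastI2[of _ j], use that \<open>avg < v j\<close> in auto)+
      have "LH m \<noteq> 0" using last_heavy_ge[of "{..<m}" i avg v] m h heavy_in[OF h] by (auto simp: LH_def)
      then have "LH m < m" "avg < v (LH m)" "i \<le> LH m"
        using last_heavy_cases[of "{..<m}" avg v] last_heavy_ge[of "{..<m}" i avg v] m h by (auto simp: LH_def)
      then have "LH m = i" using not_less_Least[of "LH m" "\<lambda>j. i < j \<and> avg < v j"] by (force simp: m_def)
      then show False using False m by auto
    qed
    then have "Y (i + k) = Y i" for k by (induction k) (simp_all add: Y_Suc surplus_def)
    then have "Y i = Y n" using heavy_in[OF h] by (metis atLeastAtMost_iff le_add_diff_inverse)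
    \<comment> \<open>Past the last heavy item \<open>Y\<close> has its final value, which is also
      the maximum of \<open>X\<close>. Hence this bucket keeps weight \<open>avg\<close>, has no
      gap, and may point to itself.\<close>
    then have "Y i = X (reach (Y i))"
      using X_eq_Y_total X_bound[of "reach (Y i)"] reach_le[of i] by simp
    moreover have "alias_index (b i) = i"
      using a_self[of i] heavy_in[OF h] heavy_X[OF h] False by auto
    ultimately show ?thesis by simp
  qed
  have light_self: "alias_index (b i) = i \<and> v i = avg"
    if "i \<in> {1..n}" "\<not> avg < v i" "\<not> X i < X (Suc i)" for i
  proof -
    have "X i = X (Suc i)" using that X_le[of i "Suc i"] by simp
    moreover have "LH j \<noteq> i" for j
      using last_heavy_cases(2)[of "{..<j}" avg v] that by (auto simp: LH_def)
    moreover have "v i = avg" using that v_pos by (simp add: X_Suc deficit_def)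
    ultimately show ?thesis using a_self that by auto
  qed
  have light_to: "avg < v (alias_index (b i))" if "X i < X (Suc i)" for i
    using a_light[OF that] by (auto simp: heavy_iff)
  have bound: "weight (b i) \<in> {0..?W / real n} \<and> alias_index (b i) \<in> {1..n}" if i: "i \<in> {1..n}" for i
  proof (cases "avg < v i")
    case True
    have "0 < Y i" using heavy_iff[of i] True Y_le[of 0 "i - 1"] by simp
    \<comment> \<open>The light item \<open>k\<close> that lifts \<open>X\<close> to
      \<open>Y i\<close> overshoots by at most its own deficit, hence by at most \<open>avg\<close>;
      this is why the heavy bucket keeps a nonnegative weight.\<close>
    then obtain k where k: "reach (Y i) = Suc k"
      using below_reach[of 0 i] by (cases "reach (Y i)") auto
    then have "X (reach (Y i)) = X k + deficit avg v k" "X k < Y i" "deficit avg v k \<le> avg"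
      using below_reach[of k i] avg_pos v_nonneg[of k] by (auto simp: X_Suc deficit_def)
    then have "0 \<le> weight (b i)" "weight (b i) \<le> avg"
      using w_heavy[OF True] reach_le[of i] by auto
    then show ?thesis using next_heavy[OF True] heavy_in i by (auto simp: avg_def)
  next
    case False
    then have "weight (b i) \<in> {0..?W / real n}" using w_light[OF i False] v_nonneg[of i] by (auto simp: avg_def)
    then show ?thesis using light_self[OF i False] light_to[of i] heavy_in i by force
  qed
  have key: "weight (b j) + (\<Sum>r=1..n. of_bool (alias_index (b r) = j) * (avg - weight (b r))) = v j"
    if j: "j \<in> {1..n}" for j
  proof (cases "avg < v j")
    case False
    have "of_bool (alias_index (b r) = j) * (avg - weight (b r)) = 0" if "r \<in> {1..n}" for r
      using False that light_to[of r] light_self[of r] next_heavy[of r] w_light[of r] by fastforce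
    then have "(\<Sum>r=1..n. of_bool (alias_index (b r) = j) * (avg - weight (b r))) = 0"
      by (intro sum.neutral) blast
    then show ?thesis using w_light[OF j False] by simp
  next
    case True
    \<comment> \<open>\<open>j\<close> gives \<open>X ?hi - X ?lo\<close> to light items (a telescoping sum) and \<open>X ?lo - Y (j - 1)\<close> to the
      heavy item before it.\<close>
    let ?lo = "reach (Y (j - 1))" and ?hi = "reach (Y j)"
    have "?lo \<le> ?hi" using below_reach[of "?hi" "j - 1"] below_reach[of "?hi" j] Y_le[of "j - 1" j]
      by (metis diff_le_self leI less_le_trans order_less_irrefl)
    have part: "of_bool (alias_index (b r) = j) * (avg - weight (b r)) =
        of_bool (r \<in> {?lo..<?hi}) * (X (Suc r) - X r) + of_bool (r = LH j) * (X (reach (Y r)) - Y r)"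
      if r: "r \<in> {1..n}" for r
    proof (cases "avg < v r")
      case hr: True
      have "LH j = r \<Longrightarrow> alias_index (b r) = j" using a_heavy[OF True] r by auto
      \<comment> \<open>A heavy bucket that is its own alias has gap 0 and so adds nothing to the
        sum.\<close>
      moreover have "alias_index (b r) = j \<Longrightarrow> LH j = r \<or> Y r = X (reach (Y r))"
        using next_heavy[OF hr] by auto
      ultimately show ?thesis using heavy_X[OF hr] w_heavy[OF hr] by auto
    next
      case False
      have ne: "r \<noteq> LH j" using last_heavy_cases(2)[of "{..<j}" avg v] False r by (auto simp: LH_def)
      have wr: "weight (b r) = v r" using w_light r False by auto
      show ?thesis
      proof (cases "X r < X (Suc r)")
        case lt: True
        then obtain k where k: "alias_index (b r) = k" "X r < Y k" "Y (k - 1) \<le> X r"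
          using a_light by auto
        have "k = j \<longleftrightarrow> r \<in> {?lo..<?hi}"
        proof -
          have "j \<le> k - 1" if "j < k" using that by simp
          moreover have "k \<le> j - 1" if "k < j" using that by simp
          moreover have "r \<in> {?lo..<?hi} \<longleftrightarrow> Y (j - 1) \<le> X r \<and> X r < Y j"
            using below_reach[of r j] below_reach[of r "j - 1"] by auto
          ultimately show ?thesis using k Y_le[of j "k - 1"] Y_le[of k "j - 1"]
            by (metis leD less_le_trans linorder_neqE_nat order.trans)
        qed
        then show ?thesis using k ne wr lt v_pos[of r] r False by (auto simp: X_Suc deficit_def)
      next
        case nl: False
        have "X (Suc r) = X r" using nl X_le[of r "Suc r"] by simp
        then show ?thesis using light_self[OF r False nl] ne wr by simp
      qed
    qed
    have "(\<Sum>r=1..n. of_bool (r \<in> {?lo..<?hi}) * (X (Suc r) - X r)) = (\<Sum>r=?lo..<?hi. X (Suc r) - X r)"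
    proof -
      have "(\<Sum>r=1..n. of_bool (r \<in> {?lo..<?hi}) * (X (Suc r) - X r)) =
          (\<Sum>r\<in>{1..n} \<inter> {?lo..<?hi}. X (Suc r) - X r)"
        by (simp add: sum.inter_restrict of_bool_def if_distrib[of "\<lambda>x. x * _"] cong: if_cong)
      also have "\<dots> = (\<Sum>r=?lo..<?hi. X (Suc r) - X r)"
      proof (rule sum.mono_neutral_left; (simp; fail)?; rule ballI)
        fix r assume "r \<in> {?lo..<?hi} - {1..n} \<inter> {?lo..<?hi}"
        then show "X (Suc r) - X r = 0" using v_zero[of r] by (auto simp: X_Suc deficit_def)
      qed
      finally show ?thesis .
    qed
    also have "\<dots> = X ?hi - X ?lo" using \<open>?lo \<le> ?hi\<close> by (rule sum_Suc_diff')
    finally have 1: "(\<Sum>r=1..n. of_bool (r \<in> {?lo..<?hi}) * (X (Suc r) - X r)) = X ?hi - X ?lo" .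
    have 2: "(\<Sum>r=1..n. of_bool (r = LH j) * (X (reach (Y r)) - Y r)) = X ?lo - Y (j - 1)"
    proof (cases "LH j = 0")
      case True
      \<comment> \<open>For the first heavy item nothing is passed on: index 0 lies outside the sum,
        and both terms on the right vanish.\<close>
      then have "Y (j - 1) = 0" using Y_LH[of j] by simp
      moreover then have "X ?lo = 0" using below_reach[of 0 "j - 1"] by (simp add: reach_def)
      ultimately show ?thesis using True by (subst sum.neutral) auto
    next
      case False
      then have "LH j \<in> {1..n}" using last_heavy_cases(2)[of "{..<j}" avg v] heavy_in by (auto simp: LH_def)
      moreover have "(\<Sum>r=1..n. of_bool (r = LH j) * (X (reach (Y r)) - Y r)) =
          (\<Sum>r=1..n. if r = LH j then X (reach (Y r)) - Y r else 0)"
        by (intro sum.cong) auto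
      ultimately show ?thesis by (simp add: Y_LH)
    qed
    have "(\<Sum>r=1..n. of_bool (alias_index (b r) = j) * (avg - weight (b r))) = X ?hi - Y (j - 1)"
      using sum.cong[OF refl part, of "{1..n}"] 1 2 by (simp only: sum.distrib)
    moreover have "Y j = Y (j - 1) + (v j - avg)"
      using j True Y_Suc[of "j - 1"] by (simp add: surplus_def)
    ultimately show ?thesis using w_heavy[OF True] by simp
  qed
  have "pmf (alias_sample n v b) j = v j / ?W" if j: "j \<in> {1..n}" for j
  proof -
    have W: "?W = avg * real n" using n_pos by (simp add: avg_def)
    have q: "0 \<le> weight (b r) * real n / ?W" "weight (b r) * real n / ?W \<le> 1" if "r \<in> {1..n}" for r
      using bound[OF that] total_pos n_pos by (auto simp: field_simps)
    have "pmf (alias_sample n v b) j =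
      (\<Sum>r=1..n. pmf (bind_pmf (bernoulli_pmf (weight (b r) * real n / ?W)) (\<lambda>stay.
        return_pmf (if stay then r else alias_index (b r)))) j) / real n"
      unfolding alias_sample_def using n_pos by (subst pmf_bind_pmf_of_set) auto
    also have "(\<Sum>r=1..n. pmf (bind_pmf (bernoulli_pmf (weight (b r) * real n / ?W)) (\<lambda>stay.
        return_pmf (if stay then r else alias_index (b r)))) j) =
      (\<Sum>r=1..n. of_bool (r = j) * (weight (b r) / avg) + of_bool (alias_index (b r) = j) * (avg - weight (b r)) / avg)"
    proof (rule sum.cong[OF refl])
      fix r assume r: "r \<in> {1..n}"
      have e: "weight (b r) * real n / ?W = weight (b r) / avg" using W n_pos by simp
      have "1 - weight (b r) / avg = (avg - weight (b r)) / avg" using avg_pos by (simp add: field_simps)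
      then show "pmf (bind_pmf (bernoulli_pmf (weight (b r) * real n / ?W)) (\<lambda>stay.
          return_pmf (if stay then r else alias_index (b r)))) j =
        of_bool (r = j) * (weight (b r) / avg) + of_bool (alias_index (b r) = j) * (avg - weight (b r)) / avg"
        using q[OF r] unfolding e by (simp add: pmf_bind pmf_return indicator_def)
    qed
    also have "\<dots> = (\<Sum>r=1..n. of_bool (r = j) * (weight (b r) / avg)) +
        (\<Sum>r=1..n. of_bool (alias_index (b r) = j) * (avg - weight (b r))) / avg"
      by (simp only: sum.distrib sum_divide_distrib)
    also have "(\<Sum>r=1..n. of_bool (r = j) * (weight (b r) / avg)) = weight (b j) / avg"
    proof -
      have "(\<Sum>r=1..n. of_bool (r = j) * (weight (b r) / avg)) = (\<Sum>r=1..n. if r = j then weight (b r) / avg else 0)"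
        by (intro sum.cong) auto
      then show ?thesis using j by simp
    qed
    also have "weight (b j) / avg + (\<Sum>r=1..n. of_bool (alias_index (b r) = j) * (avg - weight (b r))) / avg = v j / avg"
      unfolding key[OF j, symmetric] by (simp add: add_divide_distrib)
    finally show ?thesis by (simp add: W)
  qed
  then show ?thesis unfolding alias_table_def using bound by blast
qed

text \<open>
  The merge path of the sequences \<open>X\<close> and \<open>Y\<close>: among the first \<open>d\<close> steps of the merge,
  \<open>split d\<close> go to \<open>X\<close> and \<open>other d\<close> go to \<open>Y\<close>. Since \<open>Y 0 = 0\<close>, truncated subtraction
  makes the comparison fail for all \<open>i\<close> beyond \<open>d\<close>, so no bounds check is needed.
\<close>

definition split :: "nat \<Rightarrow> nat" where
  "split d = (LEAST i. \<not> X i < Y (d - Suc i))"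

text \<open>In \<open>i\<close>, \<open>X i\<close> increases and \<open>Y (d - Suc i)\<close>
  decreases, so the comparison holds on an initial segment. This permits the binary search for
  \<open>split d\<close>.\<close>

lemma below_split: "i < split d \<longleftrightarrow> X i < Y (d - Suc i)"
proof
  assume "i < split d"
  then show "X i < Y (d - Suc i)" unfolding split_def using not_less_Least by blast
next
  have "\<not> X (split d) < Y (d - Suc (split d))"
    unfolding split_def by (rule LeastI[of _ d]) (use X_le[of 0 d] in simp)
  moreover assume "X i < Y (d - Suc i)"
  ultimately show "i < split d"
    using X_le[of "split d" i] Y_le[of "d - Suc i" "d - Suc (split d)"] by (force simp: not_less)
qed

lemma split_le: "split d \<le> d"
  using below_split[of d d] X_le[of 0 d] by force

lemma split_eqI:
  assumes "\<And>i. i < c \<Longrightarrow> X i < Y (d - Suc i)" "\<not> X c < Y (d - Suc c)"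
  shows "split d = c"
  using assms(1)[of "split d"] assms(2) below_split[of c d] below_split[of "split d" d] by force

lemma split_Suc_n: "split d \<le> Suc n"
  using below_split[of "Suc n" d] Y_bound[of "d - Suc (Suc n)"] by force

abbreviation "other d \<equiv> d - split d"
abbreviation "turn d \<equiv> X (split d) < Y (other d)"

text \<open>Links the closed form to a sequential merge: from any starting position, a processor
  continues by one comparison per step.\<close>

lemma split_Suc: "split (Suc d) = split d + of_bool (turn d)"
proof (rule split_eqI)
  have le: "split d \<le> d" by (rule split_le)
  fix i assume i: "i < split d + of_bool (turn d)"
  show "X i < Y (Suc d - Suc i)"
  proof (cases "i < split d")
    case True
    then show ?thesis using below_split[of i d] Y_le[of "d - Suc i" "d - i"] by force
  next
    case False
    then have "i = split d" "turn d" using i by (cases "turn d"; simp)+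
    then show ?thesis by simp
  qed
next
  show "\<not> X (split d + of_bool (turn d)) < Y (Suc d - Suc (split d + of_bool (turn d)))"
    using below_split[of "split d" d] X_le[of "split d" "Suc (split d)"] by auto
qed

lemma split_mono: "d \<le> d' \<Longrightarrow> split d \<le> split d'"
  by (induction d' rule: dec_induct) (auto simp: split_Suc)

lemma other_mono: "d \<le> d' \<Longrightarrow> other d \<le> other d'"
proof (induction d' rule: dec_induct)
  case (step k)
  then show ?case using split_Suc[of k] split_le[of k] by auto
qed simp

text \<open>A turn of \<open>X\<close> moves \<open>split\<close> strictly forward, so the same
  index never has a second turn. This and its counterpart \<open>other_inj\<close> are the source of
  all exclusive-write arguments in the merge.\<close>

lemma split_inj: "turn d \<Longrightarrow> turn d' \<Longrightarrow> split d = split d' \<Longrightarrow> d = d'"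
proof (induction d d' rule: linorder_wlog)
  case (le d d')
  then show ?case using split_mono[of "Suc d" d'] split_Suc[of d] by (cases "d = d'") auto
next
  case (sym d d')
  then show ?case by metis
qed

lemma other_inj: "\<not> turn d \<Longrightarrow> \<not> turn d' \<Longrightarrow> other d = other d' \<Longrightarrow> d = d'"
proof (induction d d' rule: linorder_wlog)
  case (le d d')
  then show ?case using other_mono[of "Suc d" d'] split_Suc[of d] split_le[of d] by (cases "d = d'") auto
next
  case (sym d d')
  then show ?case by metis
qed

lemma turn_light: "turn d \<Longrightarrow> Y (other d - 1) \<le> X (split d)"
  using below_split[of "split d" d] by simp

text \<open>At a turn of \<open>Y\<close>, exactly the indices whose \<open>X\<close> lies below the
  current \<open>Y\<close> have been consumed, so the merge has already performed the search behind
  \<open>reach\<close>.\<close>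

lemma turn_heavy: "\<not> turn d \<Longrightarrow> X (split d) = X (reach (Y (other d))) "
proof -
  assume nt: "\<not> turn d"
  have "split d = reach (Y (other d))"
  proof (rule antisym)
    show "reach (Y (other d)) \<le> split d" using nt below_reach by force
    show "split d \<le> reach (Y (other d))"
    proof (cases "split d")
      case (Suc k)
      then have "X k < Y (d - Suc k)" using below_split[of k d] by simp
      then show ?thesis using Suc below_reach[of k "other d"] by simp
    qed simp
  qed
  then show ?thesis by simp
qed

text \<open>The position is \<open>i + j\<close> with \<open>j\<close> the first index such that
  \<open>X i < Y j\<close>: exactly the first \<open>i\<close> entries of \<open>X\<close> and the
  first \<open>j\<close> entries of \<open>Y\<close> come before.\<close>

lemma light_visited:
  assumes "X i < X (Suc i)"
  shows "\<exists>d<2 * n + 2. split d = i \<and> turn d"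
proof -
  have i: "i \<in> {1..n}" using light_strict[OF assms] by simp
  have ex: "X i < Y n" using assms X_bound[of "Suc i"] X_eq_Y_total by simp
  define j where "j = (LEAST j. X i < Y j)"
  have j: "X i < Y j" "j \<le> n" unfolding j_def using ex by (auto intro: LeastI Least_le)
  have "Y (j - 1) \<le> X i"
  proof (cases j)
    case (Suc k)
    then show ?thesis using not_less_Least[of k "\<lambda>j. X i < Y j"] unfolding j_def by force
  qed (use X_le[of 0 i] in simp)
  have "split (i + j) = i"
  proof (rule split_eqI)
    fix k assume "k < i"
    then show "X k < Y (i + j - Suc k)" using X_le[of k i] Y_le[of j "i + j - Suc k"] j by force
  qed (use \<open>Y (j - 1) \<le> X i\<close> in simp)
  then show ?thesis using i j by (intro exI[of _ "i + j"]) auto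
qed

lemma heavy_visited:
  assumes "avg < v j"
  shows "\<exists>d<2 * n + 2. other d = j \<and> \<not> turn d"
proof -
  let ?i = "reach (Y j)"
  have j: "j \<in> {1..n}" using heavy_in[OF assms] .
  have "split (?i + j) = ?i"
  proof (rule split_eqI)
    fix k assume "k < ?i"
    then show "X k < Y (?i + j - Suc k)" using below_reach[of k j] Y_le[of j "?i + j - Suc k"] by force
  next
    have "Y (j - 1) \<le> X ?i" using reach_le[of j] Y_le[of "j - 1" j] by simp
    then show "\<not> X ?i < Y (?i + j - Suc ?i)" by simp
  qed
  \<comment> \<open>\<open>reach\<close> can be \<open>Suc n\<close>, since the deficit of item
    \<open>n\<close> enters \<open>X\<close> only there. With \<open>j \<le> n\<close> the position
    is at most \<open>2 * n + 1\<close>, which explains the path length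
    \<open>2 * n + 2\<close>.\<close>
  then show ?thesis using j reach_Suc_n[of j] reach_le[of j] by (intro exI[of _ "?i + j"]) auto
qed

text \<open>This includes the default 0: the first heavy item stores its number in cell 0, outside
  the table, so that store needs no guard of its own.\<close>

lemma LH_inj:
  assumes "avg < v j" "avg < v j'" "LH j = LH j'"
  shows "j = j'"
proof -
  have "\<not> j < j'" if "avg < v j" "avg < v j'" "LH j = LH j'" for j j'
    using last_heavy_ge[of "{..<j'}" j avg v] last_heavy_cases(1)[of "{..<j}" avg v] that heavy_in[of j]
    by (auto simp: LH_def)
  then show ?thesis using assms by (metis linorder_neqE_nat)
qed

text \<open>\<open>LH j\<close> is heavy or 0, and neither adds to \<open>X\<close>; so the alias
  stores for light items and for predecessors of heavy items go to different cells.\<close>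

lemma LH_not_light: "X i < X (Suc i) \<Longrightarrow> LH j \<noteq> i"
  using light_strict[of i] last_heavy_cases(2)[of "{..<j}" avg v] by (auto simp: LH_def)

end

section \<open>Block sums and scans\<close>

text \<open>Register and array numbers have to stay numerals.\<close>

declare One_nat_def [simp del]

lemma wps_Loop_init:
  assumes "wps p ini (I 0) S"
    and "\<And>t M s r i. t < m \<Longrightarrow> I t (M, s, r) \<Longrightarrow> i < p \<Longrightarrow> holds c (s i) (r i)"
    and "\<And>M s r i. I m (M, s, r) \<Longrightarrow> i < p \<Longrightarrow> \<not> holds c (s i) (r i)"
    and "\<And>t M s r. t < m \<Longrightarrow> I t (M, s, r) \<Longrightarrow> wps p body (I (Suc t)) (M, s, r)"
  shows "wp p (ini @ [Loop c body]) p (cost ini + (m * (cost body + 1) + 1)) (I m) S"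
  by (rule wp_append, rule wp_mono[OF assms(1)[unfolded wps_def]], rule wps_Loop) (use assms in auto)

lemma block_eq:
  fixes B :: nat
  assumes "k * B + t = k' * B + t'" "t < B" "t' < B"
  shows "k = k' \<and> t = t'"
proof -
  have "k = (k * B + t) div B" using assms(2) by simp
  also have "\<dots> = (k' * B + t') div B" by (simp only: assms(1))
  also have "\<dots> = k'" using assms(3) by simp
  finally have "k = k'" .
  then show ?thesis using assms(1) by simp
qed

lemma inj_block:
  fixes B :: nat
  assumes "\<And>i. i < p \<Longrightarrow> ad i = i * B + t" "t < B"
  shows "inj_on ad {i. i < p}"
proof (rule inj_onI)
  fix i j assume "i \<in> {i. i < p}" "j \<in> {i. i < p}" "ad i = ad j"
  then have "i * B = j * B" using assms by simp
  then show "i = j" using assms by simp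
qed

lemma scatter_block:
  assumes "\<And>i. i < p \<Longrightarrow> ad i = i * B + t" "k < p" "u < B" "t < B"
  shows "scatter p (\<lambda>i. True) ad v f (k * B + u) = (if u = t then v k else f (k * B + u))"
proof (cases "u = t")
  case True
  have inj: "inj_on ad {i. i < p \<and> True}"
    using inj_block[of p ad B t] assms by simp
  have "scatter p (\<lambda>i. True) ad v f (ad k) = v k"
    by (rule scatter_hit[OF inj]) (use assms in auto)
  then show ?thesis using assms True by simp
next
  case False
  have "ad i \<noteq> k * B + u" if "i < p" for i
    using block_eq[of i B t k u] assms False that by auto
  then show ?thesis using False by (subst scatter_miss) auto
qed

lemma doubling_window:
  fixes k h :: nat
  assumes "0 < h"
  shows "{k + 1 - (h + h)..<Suc k} =
    (if h \<le> k then {k - h + 1 - h..<Suc (k - h)} \<union> {k + 1 - h..<Suc k} else {k + 1 - h..<Suc k})"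
    "{k - h + 1 - h..<Suc (k - h)} \<inter> {k + 1 - h..<Suc k} = (if h \<le> k then {} else {k - h + 1 - h..<Suc (k - h)} \<inter> {k + 1 - h..<Suc k})"
  using assms by auto

lemma scatter_shift:
  assumes "\<And>i. i < p \<Longrightarrow> ad i = i + p"
  shows "c < p \<Longrightarrow> scatter p (\<lambda>i. True) ad val f c = f c"
    and "k < p \<Longrightarrow> scatter p (\<lambda>i. True) ad val f (k + p) = val k"
proof -
  show "scatter p (\<lambda>i. True) ad val f c = f c" if "c < p"
    using that assms by (subst scatter_miss) auto
  have inj: "inj_on ad {i. i < p \<and> True}" using assms by (auto intro: inj_onI)
  show "scatter p (\<lambda>i. True) ad val f (k + p) = val k" if "k < p"
    by (rule scatter_hit[OF inj that]) (use that assms in auto)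
qed

text \<open>
  Register allocation. Naturals: 0, 1 hold these constants, 2 the number of items \<open>n\<close>, 3 the
  padded size \<open>N\<close>, 5 the block length \<open>B\<close>, 6 the number of processors \<open>p\<close>, 7 the processor
  number, 8 the start of its block, 9 the last heavy item seen. Reals: 0 holds 0, 1 the average
  weight, 2 and 3 the running sums of deficits and surpluses. Real arrays 2 and 3 receive
  \<open>X\<close> and \<open>Y\<close>, natural-number array 2 receives \<open>LH\<close>; real arrays 4 and 5 and natural-number array 3 serve
  the scan. All other registers are scratch.
\<close>

definition pass_init :: "stmt list" where
  "pass_init = [NAdd 10 8 0, NAdd 11 8 5]"

text \<open>\<open>X\<close> and \<open>LH\<close> are stored before the item is added,
  \<open>Y\<close> after it. Every bucket gets its own weight and index as defaults, which later
  remain wherever the merge does not write. Multiplying by a cast flag replaces a branch.\<close>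

definition pass_body :: "stmt list" where
  "pass_body =
    [RStore 2 10 2, NStore 2 10 9, RLoad 4 0 10, RStore 1 10 4, NStore 1 10 10,
     cmp 12 1 4, cmp 13 0 4, NSub 13 13 12,
     RCast 5 12, RSub 6 4 1, RMul 5 5 6, RAdd 3 3 5,
     RCast 5 13, RSub 6 1 4, RMul 5 5 6, RAdd 2 2 5,
     NSub 14 10 9, guarded 12 (NAdd 9 9 14),
     RStore 3 10 3, NAdd 10 10 1]"

text \<open>
  A Hillis-Steele scan. Processor \<open>k\<close> uses cell \<open>k + p\<close>, and the cells below \<open>p\<close> keep their
  initial value 0, the neutral element, so that no bounds check is needed. Truncated
  subtraction followed by addition computes the maximum.
\<close>

definition scan_init :: "stmt list" where
  "scan_init = [NConst 12 1, NAdd 13 7 6]"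

definition scan_body :: "stmt list" where
  "scan_body =
    [RStore 4 13 2, RStore 5 13 3, NStore 3 13 9, NSub 14 13 12,
     RLoad 4 4 14, RAdd 2 2 4, RLoad 4 5 14, RAdd 3 3 4,
     NLoad 14 3 14, NSub 14 14 9, NAdd 9 9 14, NAdd 12 12 12]"

text \<open>Reading the left neighbour turns the inclusive scan into an exclusive one; processor 0
  reads cell \<open>p - 1\<close>, which is 0. The last cell \<open>p + p - 1\<close> holds the
  grand total, from which the average is computed.\<close>

definition scan_final :: "stmt list" where
  "scan_final =
    [RStore 4 13 2, RStore 5 13 3, NStore 3 13 9, NSub 14 13 1,
     RLoad 2 4 14, RLoad 3 5 14, NLoad 9 3 14, NAdd 14 6 6, NSub 14 14 1, RLoad 4 5 14]"

locale layout = weights +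
  fixes L b B p :: nat
  assumes B_def: "B = 2 ^ b" and p_def: "p = 2 ^ (L - b)" and b_le: "b \<le> L"
    and L_large: "2 * n + 2 \<le> 2 ^ L"
begin

abbreviation "N \<equiv> p * B"

lemma N_eq: "N = 2 ^ L"
  using b_le by (simp add: B_def p_def flip: power_add)

lemma B_pos: "0 < B" by (simp add: B_def)
lemma p_pos: "0 < p" by (simp add: p_def)

text \<open>What all phases preserve. The zero cells of the scan arrays belong here because the scan
  runs twice.\<close>

definition env :: "memory \<Rightarrow> (nat \<Rightarrow> nat \<Rightarrow> nat) \<Rightarrow> (nat \<Rightarrow> nat \<Rightarrow> real) \<Rightarrow> bool" where
  "env M s r \<longleftrightarrow>
     (\<forall>k<p. s k 0 = 0 \<and> s k 1 = 1 \<and> s k 2 = n \<and> s k 3 = N \<and> s k 5 = B \<and> s k 6 = p \<and> s k 7 = k \<and>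
       s k 8 = k * B \<and> r k 0 = 0) \<and>
     (\<forall>c. rmem M 0 c = v c) \<and> (\<forall>c<p. rmem M 4 c = 0 \<and> rmem M 5 c = 0 \<and> nmem M 3 c = 0)"

text \<open>The carry-ins \<open>d0\<close>, \<open>s0\<close>, \<open>l0\<close> serve both uses of
  the pass: with 0 it yields block totals for the scan, with the scanned prefixes it yields
  \<open>X\<close>, \<open>Y\<close> and \<open>LH\<close>.\<close>

definition pass_inv :: "real \<Rightarrow> (nat \<Rightarrow> real) \<Rightarrow> (nat \<Rightarrow> real) \<Rightarrow> (nat \<Rightarrow> nat) \<Rightarrow> nat \<Rightarrow> state \<Rightarrow> bool" where
  "pass_inv a d0 s0 l0 t = (\<lambda>(M, s, r). env M s r \<and>
     (\<forall>k<p. s k 10 = k * B + t \<and> s k 11 = k * B + B \<and> r k 1 = a \<and>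
       r k 2 = d0 k + sum (deficit a v) {k * B..<k * B + t} \<and>
       r k 3 = s0 k + sum (surplus a v) {k * B..<k * B + t} \<and>
       s k 9 = max (l0 k) (last_heavy a v {k * B..<k * B + t}) \<and>
       (\<forall>u<t.
         rmem M 2 (k * B + u) = d0 k + sum (deficit a v) {k * B..<k * B + u} \<and>
         rmem M 3 (k * B + u) = s0 k + sum (surplus a v) {k * B..<Suc (k * B + u)} \<and>
         nmem M 2 (k * B + u) = max (l0 k) (last_heavy a v {k * B..<k * B + u}) \<and>
         rmem M 1 (k * B + u) = v (k * B + u) \<and>
         nmem M 1 (k * B + u) = k * B + u)))"

lemma pass_body:
  assumes t: "t < B" and I: "pass_inv a d0 s0 l0 t (M, s, r)"
  shows "wps p pass_body (pass_inv a d0 s0 l0 (Suc t)) (M, s, r)"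
proof -
  have reg: "s k 10 = k * B + t" "s k 11 = k * B + B" "r k 1 = a"
       "r k 2 = d0 k + sum (deficit a v) {k * B..<k * B + t}"
       "r k 3 = s0 k + sum (surplus a v) {k * B..<k * B + t}"
       "s k 9 = max (l0 k) (last_heavy a v {k * B..<k * B + t})"
       "s k 0 = 0" "s k 1 = 1" "s k 2 = n" "s k 3 = N" "s k 5 = B" "s k 6 = p" "s k 7 = k" "s k 8 = k * B" "r k 0 = 0"
    if "k < p" for k
    using I that by (simp_all add: pass_inv_def env_def)
  have mem: "rmem M 0 c = v c" "c < p \<Longrightarrow> rmem M 4 c = 0" "c < p \<Longrightarrow> rmem M 5 c = 0" "c < p \<Longrightarrow> nmem M 3 c = 0" for c
    using I by (simp_all add: pass_inv_def env_def)
  have old: "rmem M 2 (k * B + u) = d0 k + sum (deficit a v) {k * B..<k * B + u}"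
         "rmem M 3 (k * B + u) = s0 k + sum (surplus a v) {k * B..<Suc (k * B + u)}"
         "nmem M 2 (k * B + u) = max (l0 k) (last_heavy a v {k * B..<k * B + u})"
         "rmem M 1 (k * B + u) = v (k * B + u)"
         "nmem M 1 (k * B + u) = k * B + u" if "k < p" "u < t" for k u
    using I that by (simp_all add: pass_inv_def)
  have inj: "inj_on (\<lambda>i. s i 10) {i. i < p}"
    using reg(1) t by (rule inj_block)
  note sc = scatter_block[of p "\<lambda>i. s i 10" B t, OF reg(1) _ _ t]
  have Suc_block: "{k * B..<Suc (k * B + t)} = insert (k * B + t) {k * B..<k * B + t}" for k by auto
  show ?thesis
    unfolding pass_body_def
    apply (rule wps_rules)+
    subgoal premises E
      using t
      by (auto simp: E pass_inv_def env_def reg mem old sc less_Suc_eq Suc_block last_heavy_insert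
          deficit_def surplus_def)
    by (simp_all add: inj reg)
qed

lemma pass_start:
  assumes "env M s r" "\<And>k. k < p \<Longrightarrow> r k 1 = a \<and> r k 2 = d0 k \<and> r k 3 = s0 k \<and> s k 9 = l0 k"
  shows "wps p pass_init (pass_inv a d0 s0 l0 0) (M, s, r)"
  unfolding pass_init_def
  apply (rule wps_rules)+
  subgoal premises E
    using assms by (auto simp: E pass_inv_def env_def)
  done

lemma pass:
  assumes "env M s r" "\<And>k. k < p \<Longrightarrow> r k 1 = a \<and> r k 2 = d0 k \<and> r k 3 = s0 k \<and> s k 9 = l0 k"
  shows "wp p (pass_init @ [Loop (NLess 10 11) pass_body]) p
    (cost pass_init + (B * (cost pass_body + 1) + 1)) (pass_inv a d0 s0 l0 B) (M, s, r)"
proof (rule wps_Loop_init[where I="pass_inv a d0 s0 l0"])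
  show "wps p pass_init (pass_inv a d0 s0 l0 0) (M, s, r)" using assms by (rule pass_start)
next
  show "wps p pass_body (pass_inv a d0 s0 l0 (Suc t)) (M, s, r)"
    if "t < B" "pass_inv a d0 s0 l0 t (M, s, r)" for t M s r
    using that by (rule pass_body)
qed (simp_all add: pass_inv_def)

definition scan_inv :: "real \<Rightarrow> (nat \<Rightarrow> real) \<Rightarrow> (nat \<Rightarrow> real) \<Rightarrow> (nat \<Rightarrow> nat) \<Rightarrow> nat \<Rightarrow> state \<Rightarrow> bool" where
  "scan_inv a d0 s0 l0 t = (\<lambda>(M, s, r). env M s r \<and>
     (\<forall>k<p. s k 12 = 2 ^ t \<and> s k 13 = k + p \<and> r k 1 = a \<and>
       r k 2 = sum d0 {k + 1 - 2 ^ t..<Suc k} \<and> r k 3 = sum s0 {k + 1 - 2 ^ t..<Suc k} \<and>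
       s k 9 = Max (l0 ` {k + 1 - 2 ^ t..<Suc k})))"

lemma scan_body:
  assumes t: "2 ^ t < p" and I: "scan_inv a d0 s0 l0 t (M, s, r)"
  shows "wps p scan_body (scan_inv a d0 s0 l0 (Suc t)) (M, s, r)"
proof -
  have reg: "s k 12 = 2 ^ t" "s k 13 = k + p" "r k 1 = a"
       "r k 2 = sum d0 {k + 1 - 2 ^ t..<Suc k}" "r k 3 = sum s0 {k + 1 - 2 ^ t..<Suc k}"
       "s k 9 = Max (l0 ` {k + 1 - 2 ^ t..<Suc k})"
       "s k 0 = 0" "s k 1 = 1" "s k 2 = n" "s k 3 = N" "s k 5 = B" "s k 6 = p" "s k 7 = k" "s k 8 = k * B" "r k 0 = 0"
    if "k < p" for k
    using I that by (simp_all add: scan_inv_def env_def)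
  have mem: "rmem M 0 c = v c" "c < p \<Longrightarrow> rmem M 4 c = 0" "c < p \<Longrightarrow> rmem M 5 c = 0" "c < p \<Longrightarrow> nmem M 3 c = 0" for c
    using I by (simp_all add: scan_inv_def env_def)
  have inj: "inj_on (\<lambda>i. s i 13) {i. i < p}"
    using reg(2) by (auto intro: inj_onI)
  \<comment> \<open>Looking back \<open>2 ^ t\<close> cells from \<open>k + p\<close> either reaches
    a cell written in this round or falls below \<open>p\<close>, into the zeros;
    \<open>2 ^ t < p\<close> excludes truncation.\<close>
  have look: "scatter p (\<lambda>i. True) (\<lambda>i. s i 13) val f (k + p - 2 ^ t) =
      (if 2 ^ t \<le> k then val (k - 2 ^ t) else f (k + p - 2 ^ t))" if "k < p" for k and val f :: "nat \<Rightarrow> 'b"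
    using scatter_shift(1)[of p "\<lambda>i. s i 13" "k + p - 2 ^ t" val f]
      scatter_shift(2)[of p "\<lambda>i. s i 13" "k - 2 ^ t" val f, OF reg(2)] that reg(2) t by auto
  have keep: "scatter p (\<lambda>i. True) (\<lambda>i. s i 13) val f c = f c" if "c < p" for c and val f :: "nat \<Rightarrow> 'b"
    using scatter_shift(1)[of p "\<lambda>i. s i 13" c val f] that reg(2) by auto
  have sum2: "sum g {k + 1 - (2 ^ t + 2 ^ t)..<Suc k} =
      sum g {k + 1 - 2 ^ t..<Suc k} + (if 2 ^ t \<le> k then sum g {k - 2 ^ t + 1 - 2 ^ t..<Suc (k - 2 ^ t)} else 0)"
    for g :: "nat \<Rightarrow> real" and k
    using doubling_window[of "2 ^ t" k] by (auto simp: sum.union_disjoint)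
  have max2: "Max (l0 ` {k + 1 - (2 ^ t + 2 ^ t)..<Suc k}) =
      (if 2 ^ t \<le> k then max (Max (l0 ` {k + 1 - 2 ^ t..<Suc k})) (Max (l0 ` {k - 2 ^ t + 1 - 2 ^ t..<Suc (k - 2 ^ t)}))
       else Max (l0 ` {k + 1 - 2 ^ t..<Suc k}))" for k
  proof (cases "2 ^ t \<le> k")
    case True
    have "Max (l0 ` {k + 1 - 2 ^ t..<Suc k} \<union> l0 ` {k - 2 ^ t + 1 - 2 ^ t..<Suc (k - 2 ^ t)}) =
        max (Max (l0 ` {k + 1 - 2 ^ t..<Suc k})) (Max (l0 ` {k - 2 ^ t + 1 - 2 ^ t..<Suc (k - 2 ^ t)}))"
    proof (rule Max_Un)
      have "k \<in> {k + 1 - 2 ^ t..<Suc k}" "k - 2 ^ t \<in> {k - 2 ^ t + 1 - 2 ^ t..<Suc (k - 2 ^ t)}"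
        using one_le_power[of "2::nat" t] by (auto simp: le_diff_conv)
      then show "l0 ` {k + 1 - 2 ^ t..<Suc k} \<noteq> {}" "l0 ` {k - 2 ^ t + 1 - 2 ^ t..<Suc (k - 2 ^ t)} \<noteq> {}"
        by blast+
    qed simp_all
    then show ?thesis
      unfolding doubling_window(1)[of "2 ^ t" k, OF zero_less_power[OF zero_less_numeral]]
      using True by (simp only: image_Un if_True Un_commute)
  qed (use doubling_window(1)[of "2 ^ t" k] in simp)
  have pow: "(2::nat) ^ Suc t = 2 ^ t + 2 ^ t" by simp
  show ?thesis
    unfolding scan_body_def
    apply (rule wps_rules)+
    subgoal premises E
      unfolding scan_inv_def env_def prod.case pow sum2 max2
      using t by (auto simp: E reg mem look keep max_def)
    by (simp_all add: inj reg)
qed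

lemma scan_start:
  assumes "env M s r" "\<And>k. k < p \<Longrightarrow> r k 1 = a \<and> r k 2 = d0 k \<and> r k 3 = s0 k \<and> s k 9 = l0 k"
  shows "wps p scan_init (scan_inv a d0 s0 l0 0) (M, s, r)"
  unfolding scan_init_def
  apply (rule wps_rules)+
  subgoal premises E
    using assms by (auto simp: E scan_inv_def env_def)
  done

definition scan_post :: "real \<Rightarrow> (nat \<Rightarrow> real) \<Rightarrow> (nat \<Rightarrow> real) \<Rightarrow> (nat \<Rightarrow> nat) \<Rightarrow> state \<Rightarrow> bool" where
  "scan_post a d0 s0 l0 = (\<lambda>(M, s, r). env M s r \<and>
     (\<forall>k<p. r k 1 = a \<and> r k 2 = sum d0 {..<k} \<and> r k 3 = sum s0 {..<k} \<and>
       s k 9 = Max (insert 0 (l0 ` {..<k})) \<and> r k 4 = sum s0 {..<p}))"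

lemma scan_final:
  assumes I: "scan_inv a d0 s0 l0 (L - b) (M, s, r)"
  shows "wps p scan_final (scan_post a d0 s0 l0) (M, s, r)"
proof -
  have win: "{k + 1 - 2 ^ (L - b)..<Suc k} = {..<Suc k}" if "k < p" for k
    using that by (auto simp: p_def)
  have reg: "s k 13 = k + p" "r k 1 = a"
       "r k 2 = sum d0 {..<Suc k}" "r k 3 = sum s0 {..<Suc k}"
       "s k 9 = Max (l0 ` {..<Suc k})"
       "s k 0 = 0" "s k 1 = 1" "s k 2 = n" "s k 3 = N" "s k 5 = B" "s k 6 = p" "s k 7 = k" "s k 8 = k * B" "r k 0 = 0"
    if "k < p" for k
    using I that by (simp_all add: scan_inv_def env_def win del: sum.op_ivl_Suc sum.lessThan_Suc lessThan_Suc)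
  have mem: "rmem M 0 c = v c" "c < p \<Longrightarrow> rmem M 4 c = 0" "c < p \<Longrightarrow> rmem M 5 c = 0" "c < p \<Longrightarrow> nmem M 3 c = 0" for c
    using I by (simp_all add: scan_inv_def env_def)
  have inj: "inj_on (\<lambda>i. s i 13) {i. i < p}"
    using reg(1) by (auto intro: inj_onI)
  have look: "scatter p (\<lambda>i. True) (\<lambda>i. s i 13) val f (k + p - 1) =
      (if k = 0 then f (p - 1) else val (k - 1))" if "k < p" for k and val f :: "nat \<Rightarrow> 'b"
    using scatter_shift(1)[of p "\<lambda>i. s i 13" "p - 1" val f, OF reg(1)]
      scatter_shift(2)[of p "\<lambda>i. s i 13" "k - 1" val f, OF reg(1)] that p_pos by auto
  have last: "scatter p (\<lambda>i. True) (\<lambda>i. s i 13) val f (p + p - 1) = val (p - 1)" for val f :: "nat \<Rightarrow> 'b"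
    using scatter_shift(2)[of p "\<lambda>i. s i 13" "p - 1" val f, OF reg(1)] p_pos by simp
  have keep: "scatter p (\<lambda>i. True) (\<lambda>i. s i 13) val f c = f c" if "c < p" for c and val f :: "nat \<Rightarrow> 'b"
    using scatter_shift(1)[of p "\<lambda>i. s i 13" c val f] that reg(1) by auto
  have ins: "Max (insert 0 (l0 ` {..<k})) = Max (l0 ` {..<k})" if "0 < k" for k
    using that by (subst Max_insert) auto
  show ?thesis
    unfolding scan_final_def
    apply (rule wps_rules)+
    subgoal premises E
      unfolding scan_post_def env_def prod.case
      using p_pos by (auto simp: E reg mem look keep last ins simp del: lessThan_Suc)
    by (simp_all add: inj reg)
qed

lemma scan:
  assumes "env M s r" "\<And>k. k < p \<Longrightarrow> r k 1 = a \<and> r k 2 = d0 k \<and> r k 3 = s0 k \<and> s k 9 = l0 k"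
  shows "wp p ((scan_init @ [Loop (NLess 12 6) scan_body]) @ scan_final) p
    (cost scan_init + ((L - b) * (cost scan_body + 1) + 1) + cost scan_final) (scan_post a d0 s0 l0) (M, s, r)"
proof (rule wp_append, rule wp_mono, rule wps_Loop_init[where I="scan_inv a d0 s0 l0"])
  show "wps p scan_init (scan_inv a d0 s0 l0 0) (M, s, r)" using assms by (rule scan_start)
next
  show "wps p scan_body (scan_inv a d0 s0 l0 (Suc t)) (M, s, r)"
    if "t < L - b" "scan_inv a d0 s0 l0 t (M, s, r)" for t M s r
    using that by (intro scan_body) (simp_all add: p_def)
next
  show "wp p scan_final p (cost scan_final) (scan_post a d0 s0 l0) S"
    if "scan_inv a d0 s0 l0 (L - b) S" for S
    using that scan_final by (cases S) (auto simp: wps_def)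
next
  have p2: "2 ^ t < p \<longleftrightarrow> t < L - b" for t by (simp add: p_def)
  show "holds (NLess 12 6) (s i) (r i)"
    if "t < L - b" "scan_inv a d0 s0 l0 t (M, s, r)" "i < p" for t M s r i
    using that by (simp add: scan_inv_def env_def p2)
  show "\<not> holds (NLess 12 6) (s i) (r i)"
    if "scan_inv a d0 s0 l0 (L - b) (M, s, r)" "i < p" for M s r i
    using that by (simp add: scan_inv_def env_def p2)
qed

end

section \<open>Searching and merging\<close>

lemma cost_append: "cost (cs @ cs') = cost cs + cost cs'"
proof (induction cs)
  case (Cons c cs)
  then show ?case by (cases c) auto
qed simp

lemma wps_append: "wps p cs (wps p cs' Q) S \<Longrightarrow> wps p (cs @ cs') Q S"
  unfolding wps_def cost_append by (rule wp_append)

definition search_init :: "stmt list" where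
  "search_init = [NConst 15 0, NHalf 12 3]"

text \<open>Binary lifting: the bits of \<open>split (k * B)\<close> are decided from the top.
  Raising the candidate by \<open>h\<close> is right iff the last index gained is still below the
  split.\<close>

definition search_body :: "stmt list" where
  "search_body =
    [NAdd 13 15 12, NSub 14 13 1, RLoad 4 2 14, NSub 14 8 13, RLoad 5 3 14, cmp 14 4 5,
     guarded 14 (NAdd 15 15 12), NHalf 12 12]"

definition merge_init :: "stmt list" where
  "merge_init = [NAdd 10 8 0, NAdd 11 8 5]"

text \<open>On 0/1 flags, \<open>x + y - 1\<close> is conjunction and truncated \<open>x - y\<close>
  is "x and not y". Whether an item needs treatment is read off the increments of \<open>X\<close>
  and \<open>Y\<close> instead of its weight.\<close>

definition merge_compute :: "stmt list" where
  "merge_compute =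
    [NSub 12 10 15, RLoad 4 2 15, RLoad 5 3 12, cmp 13 4 5,
     NAdd 14 15 1, RLoad 6 2 14, cmp 14 4 6, NAdd 14 14 13, NSub 14 14 1,
     NSub 16 12 1, RLoad 6 3 16, cmp 16 6 5, NSub 16 16 13,
     NLoad 17 2 12, RAdd 6 1 5, RSub 6 6 4]"

definition merge_write :: "stmt list" where
  "merge_write =
    [guarded 16 (RStore 1 12 6), guarded 16 (NStore 1 17 12), guarded 14 (NStore 1 15 12),
     NAdd 15 15 13, NAdd 10 10 1]"

section \<open>Correctness of search and merge\<close>

context layout
begin

lemma N_large: "2 * n + 2 \<le> N"
  using L_large by (simp add: N_eq)

lemma block_less: "k < p \<Longrightarrow> t < B \<Longrightarrow> k * B + t < N"
proof -
  assume "k < p" "t < B"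
  then have "k * B + t < Suc k * B" "Suc k * B \<le> p * B" by (auto intro: mult_right_mono simp del: mult_Suc) simp
  then show ?thesis by simp
qed

definition known :: "memory \<Rightarrow> (nat \<Rightarrow> nat \<Rightarrow> nat) \<Rightarrow> (nat \<Rightarrow> nat \<Rightarrow> real) \<Rightarrow> bool" where
  "known M s r \<longleftrightarrow> env M s r \<and> (\<forall>k<p. r k 1 = avg) \<and>
     (\<forall>c<N. rmem M 2 c = X c \<and> rmem M 3 c = Y c \<and> nmem M 2 c = LH c)"

text \<open>\<open>D\<close> holds the merge positions already executed. The first and last clauses
  concern cells that no position writes, so they keep their defaults from the pass.\<close>

definition table_inv :: "nat set \<Rightarrow> memory \<Rightarrow> bool" where
  "table_inv D M \<longleftrightarrow>
     (\<forall>j<N. \<not> avg < v j \<longrightarrow> rmem M 1 j = v j) \<and>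
     (\<forall>d\<in>D. \<not> turn d \<longrightarrow> avg < v (other d) \<longrightarrow>
       rmem M 1 (other d) = avg + Y (other d) - X (split d) \<and> nmem M 1 (LH (other d)) = other d) \<and>
     (\<forall>d\<in>D. turn d \<longrightarrow> X (split d) < X (Suc (split d)) \<longrightarrow> nmem M 1 (split d) = other d) \<and>
     (\<forall>c<N. \<not> X c < X (Suc c) \<longrightarrow> (\<forall>j. avg < v j \<longrightarrow> LH j \<noteq> c) \<longrightarrow> nmem M 1 c = c)"

text \<open>At \<open>t = L\<close> the step width is \<open>1 div 2 = 0\<close>, which ends the
  loop, and the interval has length 1, which determines the split.\<close>

definition search_inv :: "nat \<Rightarrow> state \<Rightarrow> bool" where
  "search_inv t = (\<lambda>(M, s, r). known M s r \<and> table_inv {} M \<and>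
     (\<forall>k<p. s k 12 = 2 ^ (L - t) div 2 \<and> s k 15 + 2 ^ (L - t) \<le> N \<and>
       s k 15 \<le> split (k * B) \<and> split (k * B) < s k 15 + 2 ^ (L - t)))"

lemma search_start:
  assumes "known M s r" "table_inv {} M"
  shows "wps p search_init (search_inv 0) (M, s, r)"
proof -
  have "split (k * B) < 2 ^ L" if "k < p" for k
    using split_Suc_n[of "k * B"] L_large n_pos by simp
  then show ?thesis
    unfolding search_init_def
    apply -
    apply (rule wps_rules)+
    subgoal premises E
      using assms E(1) by (auto simp: E(2-) search_inv_def known_def env_def N_eq)
    done
qed

lemma search_body:
  assumes t: "t < L" and I: "search_inv t (M, s, r)"
  shows "wps p search_body (search_inv (Suc t)) (M, s, r)"
proof -
  define h :: nat where "h = 2 ^ (L - Suc t)"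
  have h: "2 ^ (L - t) = 2 * h" "2 ^ (L - Suc t) = h" "0 < h"
    using t by (auto simp: h_def simp flip: power_Suc Suc_diff_Suc)
  have reg: "s k 12 = h" "s k 15 + 2 * h \<le> N" "s k 15 \<le> split (k * B)" "split (k * B) < s k 15 + 2 * h"
       "s k 0 = 0" "s k 1 = 1" "s k 2 = n" "s k 3 = N" "s k 5 = B" "s k 6 = p" "s k 7 = k" "s k 8 = k * B" "r k 0 = 0"
       "r k 1 = avg"
    if "k < p" for k
    using I that by (simp_all add: search_inv_def known_def env_def h)
  have mem: "rmem M 0 c = v c" "c < p \<Longrightarrow> rmem M 4 c = 0" "c < p \<Longrightarrow> rmem M 5 c = 0" "c < p \<Longrightarrow> nmem M 3 c = 0"
    "c < N \<Longrightarrow> rmem M 2 c = X c" "c < N \<Longrightarrow> rmem M 3 c = Y c" "c < N \<Longrightarrow> nmem M 2 c = LH c" for c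
    using I by (simp_all add: search_inv_def known_def env_def)
  have reg': "s k 15 + h + h \<le> N" "s k 15 + h \<le> N" "split (k * B) < s k 15 + h + h" if "k < p" for k
    using reg(2,4)[OF that] by simp_all
  have tab: "table_inv {} M" using I by (simp add: search_inv_def)
  have load: "rmem M 2 (s k 15 + h - 1) = X (s k 15 + h - 1)"
      "rmem M 3 (k * B - (s k 15 + h)) = Y (k * B - (s k 15 + h))"
      "X (s k 15 + h - 1) < Y (k * B - (s k 15 + h)) \<longleftrightarrow> s k 15 + h \<le> split (k * B)" if "k < p" for k
  proof -
    show "rmem M 2 (s k 15 + h - 1) = X (s k 15 + h - 1)"
      using reg(2)[OF that] h(3) by (intro mem) auto
    show "rmem M 3 (k * B - (s k 15 + h)) = Y (k * B - (s k 15 + h))"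
      using block_less[OF that B_pos] by (intro mem) linarith
    show "X (s k 15 + h - 1) < Y (k * B - (s k 15 + h)) \<longleftrightarrow> s k 15 + h \<le> split (k * B)"
      using below_split[of "s k 15 + h - 1" "k * B"] h(3) by (auto simp: Suc_diff_1)
  qed
  show ?thesis
    unfolding search_body_def
    apply (rule wps_rules)+
    subgoal premises E
      by (auto simp: E search_inv_def known_def env_def reg reg' mem tab load h)
    by (simp_all add: reg)
qed

lemma search:
  assumes "known M s r" "table_inv {} M"
  shows "wp p (search_init @ [Loop (NLess 0 12) search_body]) p
    (cost search_init + (L * (cost search_body + 1) + 1)) (search_inv L) (M, s, r)"
proof (rule wps_Loop_init[where I=search_inv])
  show "wps p search_init (search_inv 0) (M, s, r)" using assms by (rule search_start)
next
  show "wps p search_body (search_inv (Suc t)) (M, s, r)"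
    if "t < L" "search_inv t (M, s, r)" for t M s r
    using that by (rule search_body)
next
  show "holds (NLess 0 12) (s i) (r i)" if "t < L" "search_inv t (M, s, r)" "i < p" for t M s r i
  proof -
    have "2 ^ (L - t) = 2 * (2::nat) ^ (L - Suc t)" using that(1) by (simp flip: power_Suc Suc_diff_Suc)
    then show ?thesis using that by (auto simp: search_inv_def known_def env_def)
  qed
next
  show "\<not> holds (NLess 0 12) (s i) (r i)" if "search_inv L (M, s, r)" "i < p" for M s r i
    using that by (auto simp: search_inv_def known_def env_def)
qed

text \<open>In lockstep, \<open>t\<close> rounds cover the first \<open>t\<close> positions of every
  block, not an initial segment of the path.\<close>

definition swept :: "nat \<Rightarrow> nat set" where
  "swept t = {d. d < N \<and> d mod B < t}"

definition merge_inv :: "nat \<Rightarrow> state \<Rightarrow> bool" where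
  "merge_inv t = (\<lambda>(M, s, r). known M s r \<and> table_inv (swept t) M \<and>
     (\<forall>k<p. s k 10 = k * B + t \<and> s k 11 = k * B + B \<and> s k 15 = split (k * B + t)))"

lemma merge_start:
  assumes "search_inv L (M, s, r)"
  shows "wps p merge_init (merge_inv 0) (M, s, r)"
  unfolding merge_init_def
  apply (rule wps_rules)+
  subgoal premises E
    using assms by (auto simp: E merge_inv_def search_inv_def known_def env_def swept_def)
  done

text \<open>States the flag registers as predicates on the path; the injectivity of the three
  guarded stores is derived from them.\<close>

definition merge_mid :: "nat \<Rightarrow> state \<Rightarrow> bool" where
  "merge_mid t = (\<lambda>(M, s, r). known M s r \<and> table_inv (swept t) M \<and>
     (\<forall>k<p. let d = k * B + t in s k 10 = d \<and> s k 11 = k * B + B \<and> s k 15 = split d \<and>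
        s k 12 = other d \<and> s k 17 = LH (other d) \<and> s k 13 = of_bool (turn d) \<and>
        s k 14 = of_bool (turn d \<and> X (split d) < X (Suc (split d))) \<and>
        s k 16 = of_bool (\<not> turn d \<and> avg < v (other d)) \<and>
        r k 6 = avg + Y (other d) - X (split d)))"

lemma merge_compute:
  assumes t: "t < B" and I: "merge_inv t (M, s, r)"
  shows "wps p merge_compute (merge_mid t) (M, s, r)"
proof -
  have reg: "s k 10 = k * B + t" "s k 11 = k * B + B" "s k 15 = split (k * B + t)"
       "s k 0 = 0" "s k 1 = 1" "s k 2 = n" "s k 3 = N" "s k 5 = B" "s k 6 = p" "s k 7 = k" "s k 8 = k * B" "r k 0 = 0"
       "r k 1 = avg"
    if "k < p" for k
    using I that by (simp_all add: merge_inv_def known_def env_def)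
  have mem: "rmem M 0 c = v c" "c < p \<Longrightarrow> rmem M 4 c = 0" "c < p \<Longrightarrow> rmem M 5 c = 0" "c < p \<Longrightarrow> nmem M 3 c = 0"
    "c < N \<Longrightarrow> rmem M 2 c = X c" "c < N \<Longrightarrow> rmem M 3 c = Y c" "c < N \<Longrightarrow> nmem M 2 c = LH c" for c
    using I by (simp_all add: merge_inv_def known_def env_def)
  have tab: "table_inv (swept t) M" using I by (simp add: merge_inv_def)
  have load: "rmem M 2 (split (k * B + t)) = X (split (k * B + t))"
      "rmem M 2 (split (k * B + t) + 1) = X (Suc (split (k * B + t)))"
      "rmem M 3 (other (k * B + t)) = Y (other (k * B + t))"
      "rmem M 3 (other (k * B + t) - 1) = Y (other (k * B + t) - 1)"
      "nmem M 2 (other (k * B + t)) = LH (other (k * B + t))" if "k < p" for k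
  proof -
    have s: "split (k * B + t) + 1 < N"
      using split_Suc_n[of "k * B + t"] N_large n_pos by simp
    have o: "other (k * B + t) < N"
      using block_less[OF that t] by simp
    show "rmem M 2 (split (k * B + t)) = X (split (k * B + t))"
      "rmem M 2 (split (k * B + t) + 1) = X (Suc (split (k * B + t)))"
      "rmem M 3 (other (k * B + t)) = Y (other (k * B + t))"
      "rmem M 3 (other (k * B + t) - 1) = Y (other (k * B + t) - 1)"
      "nmem M 2 (other (k * B + t)) = LH (other (k * B + t))"
      using s o mem(5)[OF s] by (simp_all add: mem del: Suc_eq_plus1 flip: Suc_eq_plus1)
  qed
  show ?thesis
    unfolding merge_compute_def
    apply (rule wps_rules)+
    subgoal premises E
      by (auto simp: E merge_mid_def known_def env_def reg mem tab load load(4)[unfolded diff_diff_left] heavy_iff Let_def)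
    done
qed

lemma merge_write:
  assumes t: "t < B" and I: "merge_mid t (M, s, r)"
  shows "wps p merge_write (merge_inv (Suc t)) (M, s, r)"
proof -
  have reg: "s k 10 = k * B + t" "s k 11 = k * B + B" "s k 15 = split (k * B + t)"
       "s k 12 = other (k * B + t)" "s k 17 = LH (other (k * B + t))" "s k 13 = of_bool (turn (k * B + t))"
       "s k 14 = of_bool (turn (k * B + t) \<and> X (split (k * B + t)) < X (Suc (split (k * B + t))))"
       "s k 16 = of_bool (\<not> turn (k * B + t) \<and> avg < v (other (k * B + t)))"
       "r k 6 = avg + Y (other (k * B + t)) - X (split (k * B + t))"
       "s k 0 = 0" "s k 1 = 1" "s k 2 = n" "s k 3 = N" "s k 5 = B" "s k 6 = p" "s k 7 = k" "s k 8 = k * B" "r k 0 = 0"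
       "r k 1 = avg"
    if "k < p" for k
    using I that by (simp_all add: merge_mid_def known_def env_def Let_def)
  have mem: "rmem M 0 c = v c" "c < p \<Longrightarrow> rmem M 4 c = 0" "c < p \<Longrightarrow> rmem M 5 c = 0" "c < p \<Longrightarrow> nmem M 3 c = 0"
    "c < N \<Longrightarrow> rmem M 2 c = X c" "c < N \<Longrightarrow> rmem M 3 c = Y c" "c < N \<Longrightarrow> nmem M 2 c = LH c" for c
    using I by (simp_all add: merge_mid_def known_def env_def)
  have tab: "table_inv (swept t) M" using I by (simp add: merge_mid_def)
  define H where "H k \<longleftrightarrow> 0 < s k 16" for k
  define G where "G k \<longleftrightarrow> 0 < s k 14" for k
  have H: "H k \<longleftrightarrow> \<not> turn (k * B + t) \<and> avg < v (other (k * B + t))" if "k < p" for k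
    using reg that by (simp add: H_def)
  have G: "G k \<longleftrightarrow> turn (k * B + t) \<and> X (split (k * B + t)) < X (Suc (split (k * B + t)))" if "k < p" for k
    using reg that by (simp add: G_def)
  have same: "k = k'" if "k * B + t = k' * B + t" for k k'
    using that B_pos by simp
  have injR: "inj_on (\<lambda>i. s i 12) {i. i < p \<and> H i}"
  proof (rule inj_onI)
    fix i j assume "i \<in> {i. i < p \<and> H i}" "j \<in> {i. i < p \<and> H i}" "s i 12 = s j 12"
    then have ij: "i < p" "j < p" "H i" "H j" "s i 12 = s j 12" by simp_all
    note ij' = ij(3)[unfolded H[OF ij(1)]] ij(4)[unfolded H[OF ij(2)]] ij(5)[unfolded reg(4)[OF ij(1)] reg(4)[OF ij(2)]]
    show "i = j" by (rule same) (use ij' other_inj in blast)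
  qed
  have injL: "inj_on (\<lambda>i. s i 17) {i. i < p \<and> H i}"
  proof (rule inj_onI)
    fix i j assume "i \<in> {i. i < p \<and> H i}" "j \<in> {i. i < p \<and> H i}" "s i 17 = s j 17"
    then have ij: "i < p" "j < p" "H i" "H j" "s i 17 = s j 17" by simp_all
    note ij' = ij(3)[unfolded H[OF ij(1)]] ij(4)[unfolded H[OF ij(2)]] ij(5)[unfolded reg(5)[OF ij(1)] reg(5)[OF ij(2)]]
    show "i = j" by (rule same) (use ij' other_inj LH_inj in blast)
  qed
  have injS: "inj_on (\<lambda>i. s i 15) {i. i < p \<and> G i}"
  proof (rule inj_onI)
    fix i j assume "i \<in> {i. i < p \<and> G i}" "j \<in> {i. i < p \<and> G i}" "s i 15 = s j 15"
    then have ij: "i < p" "j < p" "G i" "G j" "s i 15 = s j 15" by simp_all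
    note ij' = ij(3)[unfolded G[OF ij(1)]] ij(4)[unfolded G[OF ij(2)]] ij(5)[unfolded reg(3)[OF ij(1)] reg(3)[OF ij(2)]]
    show "i = j" by (rule same) (use ij' split_inj in blast)
  qed
  let ?R = "scatter p H (\<lambda>i. s i 12) (\<lambda>i. r i 6) (rmem M 1)"
  let ?A = "scatter p H (\<lambda>i. s i 17) (\<lambda>i. s i 12) (nmem M 1)"
  let ?A' = "scatter p G (\<lambda>i. s i 15) (\<lambda>i. s i 12) ?A"
  have R_miss: "?R c = rmem M 1 c" if "\<And>k. k < p \<Longrightarrow> H k \<Longrightarrow> other (k * B + t) \<noteq> c" for c
    using that reg(4) by (intro scatter_miss) auto
  have A_miss: "?A c = nmem M 1 c" if "\<And>k. k < p \<Longrightarrow> H k \<Longrightarrow> LH (other (k * B + t)) \<noteq> c" for c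
    using that reg(5) by (intro scatter_miss) auto
  have A'_miss: "?A' c = ?A c" if "\<And>k. k < p \<Longrightarrow> G k \<Longrightarrow> split (k * B + t) \<noteq> c" for c
    using that reg(3) by (intro scatter_miss) auto
  have new: "d = d div B * B + t \<and> d div B < p" if "d < N" "d mod B = t" for d
    using that B_pos div_mult_mod_eq[of d B] by (auto simp: less_mult_imp_div_less)
  have old: "d \<noteq> k * B + t" if "d mod B < t" for d k
    using that t by auto
  have tab': "table_inv (swept (Suc t)) M'" if M': "rmem M' 1 = ?R" "nmem M' 1 = ?A'" for M'
    unfolding table_inv_def M'
  proof (intro conjI allI impI ballI)
    fix j assume "j < N" "\<not> avg < v j"
    then show "?R j = v j" using tab H by (subst R_miss) (auto simp: table_inv_def)
  next
    fix d assume d: "d \<in> swept (Suc t)" "\<not> turn d" "avg < v (other d)"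
    \<comment> \<open>The later store for light items cannot undo the alias given to a predecessor
      of a heavy item.\<close>
    have A': "?A' (LH (other d)) = ?A (LH (other d))"
      using G LH_not_light by (intro A'_miss) metis
    consider "d < N" "d mod B = t" | "d \<in> swept t" "d mod B < t" using d(1) by (force simp: swept_def)
    then show "?R (other d) = avg + Y (other d) - X (split d)" "?A' (LH (other d)) = other d"
      unfolding A'
    proof (atomize(full), cases)
      case 1
      define k where "k = d div B"
      have k: "k < p" "d = k * B + t" using new[OF 1] by (auto simp: k_def)
      then have "H k" using d H by simp
      then have "?R (s k 12) = r k 6" "?A (s k 17) = s k 12"
        by (simp_all add: scatter_hit[OF injR k(1) _ refl] scatter_hit[OF injL k(1) _ refl])
      then show "?R (other d) = avg + Y (other d) - X (split d) \<and> ?A (LH (other d)) = other d"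
        using reg[OF k(1)] k(2) by simp
    next
      case 2
      \<comment> \<open>An entry from an earlier round survives: sharing its index with a position
        of this round would make the two positions equal.\<close>
      have "other (k * B + t) \<noteq> other d" if "k < p" "H k" for k
        using other_inj[of "k * B + t" d] H that d old[OF 2(2), of k] by metis
      moreover from this have "LH (other (k * B + t)) \<noteq> LH (other d)" if "k < p" "H k" for k
        using LH_inj[of "other (k * B + t)" "other d"] H that d by metis
      ultimately show "?R (other d) = avg + Y (other d) - X (split d) \<and> ?A (LH (other d)) = other d"
        using tab 2 d by (simp add: R_miss A_miss table_inv_def)
    qed
  next
    fix d assume d: "d \<in> swept (Suc t)" "turn d" "X (split d) < X (Suc (split d))"
    consider "d < N" "d mod B = t" | "d \<in> swept t" "d mod B < t" using d(1) by (force simp: swept_def)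
    then show "?A' (split d) = other d"
    proof cases
      case 1
      define k where "k = d div B"
      have k: "k < p" "d = k * B + t" using new[OF 1] by (auto simp: k_def)
      then have "G k" using d G by simp
      then have "?A' (s k 15) = s k 12" by (simp add: scatter_hit[OF injS k(1) _ refl])
      then show ?thesis using reg[OF k(1)] k(2) by simp
    next
      case 2
      have "split (k * B + t) \<noteq> split d" if "k < p" "G k" for k
        using split_inj[of "k * B + t" d] G that d old[OF 2(2), of k] by metis
      moreover have "LH (other (k * B + t)) \<noteq> split d" for k
        using LH_not_light d by blast
      ultimately show ?thesis using tab 2 d by (simp add: A'_miss A_miss table_inv_def)
    qed
  next
    fix c assume c: "c < N" "\<not> X c < X (Suc c)" "\<forall>j. avg < v j \<longrightarrow> LH j \<noteq> c"
    then have "?A' c = nmem M 1 c" using G H by (subst A'_miss, force, subst A_miss) auto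
    then show "?A' c = c" using tab c by (simp add: table_inv_def)
  qed
  show ?thesis
    unfolding merge_write_def
    apply (rule wps_rules)+
    subgoal premises E
    proof -
      note E' = E[folded H_def G_def]
      show ?thesis
        unfolding merge_inv_def prod.case
        apply (intro conjI)
        subgoal by (simp add: known_def env_def E reg mem)
        subgoal by (rule tab') (simp_all add: E fun_eq_iff flip: H_def G_def)
        subgoal by (simp add: E reg split_Suc)
        done
    qed
    by (use injR injL injS in \<open>simp_all add: reg H_def G_def\<close>)
qed

lemma merge:
  assumes "search_inv L S"
  shows "wp p (merge_init @ [Loop (NLess 10 11) (merge_compute @ merge_write)]) p
    (cost merge_init + (B * (cost (merge_compute @ merge_write) + 1) + 1)) (merge_inv B) S"
proof (rule wps_Loop_init[where I=merge_inv])
  show "wps p merge_init (merge_inv 0) S" using assms merge_start by (cases S) auto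
next
  show "wps p (merge_compute @ merge_write) (merge_inv (Suc t)) (M, s, r)"
    if "t < B" "merge_inv t (M, s, r)" for t M s r
  proof (rule wps_append)
    have "wps p merge_compute (merge_mid t) (M, s, r)" using that by (rule merge_compute)
    then show "wps p merge_compute (wps p merge_write (merge_inv (Suc t))) (M, s, r)"
      unfolding wps_def[of p merge_compute] by (rule wp_mono) (use merge_write that in auto)
  qed
qed (simp_all add: merge_inv_def)

lemma merge_result:
  assumes "merge_inv B (M, s, r)" and w: "\<And>i. i \<in> {1..n} \<Longrightarrow> w i = v i"
  shows "alias_table n w (output_table (M, f))"
proof -
  have total: "total_weight n w = total_weight n v" using w by (simp add: total_weight_def)
  have sample: "alias_sample n w = alias_sample n v" by (simp add: alias_sample_def total fun_eq_iff)
  have "swept B = {..<N}" using B_pos by (auto simp: swept_def)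
  then have tab: "table_inv {..<N} M" using assms by (simp add: merge_inv_def)
  have in_N: "j \<in> {1..n} \<Longrightarrow> j < N" for j using N_large by auto
  have visit: "\<exists>d<N. other d = j \<and> \<not> turn d" if "avg < v j" for j
    using heavy_visited[OF that] N_large order_less_le_trans by blast
  have "alias_table n v (output_table (M, f))"
  proof (rule alias_table_criterion)
    fix j assume "j \<in> {1..n}" "\<not> avg < v j"
    then show "weight (output_table (M, f) j) = v j"
      using tab in_N by (simp add: table_inv_def output_table_def)
  next
    fix j assume h: "avg < v j"
    then obtain d where "d < N" "other d = j" "\<not> turn d" using visit by blast
    then show "weight (output_table (M, f) j) = avg + Y j - X (reach (Y j))"
      using tab h turn_heavy[of d] by (auto simp: table_inv_def output_table_def)
  next
    fix i assume l: "X i < X (Suc i)"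
    then obtain d where d: "d < N" "split d = i" "turn d"
      using light_visited[OF l] N_large order_less_le_trans by blast
    then have "nmem M 1 i = other d" using tab l by (auto simp: table_inv_def)
    then show "\<exists>j. alias_index (output_table (M, f) i) = j \<and> X i < Y j \<and> Y (j - 1) \<le> X i"
      using d turn_light[of d] by (auto simp: output_table_def)
  next
    fix j assume h: "avg < v j"
    then obtain d where "d < N" "other d = j" "\<not> turn d" using visit by blast
    then show "alias_index (output_table (M, f) (LH j)) = j"
      using tab h by (auto simp: table_inv_def output_table_def)
  next
    fix i assume "i \<in> {1..n}" "X i = X (Suc i)" "\<And>j. avg < v j \<Longrightarrow> LH j \<noteq> i"
    then show "alias_index (output_table (M, f) i) = i"
      using tab in_N by (simp add: table_inv_def output_table_def)
  qed
  then show ?thesis using w by (simp add: alias_table_def total sample)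
qed

end

section \<open>The parallel part\<close>

definition clear :: "stmt list" where
  "clear = [RSub 2 2 2, RSub 3 3 3, NSub 9 9 9]"

definition set_avg :: "stmt list" where
  "set_avg = [RCast 5 2, RDiv 1 4 5]"

definition pass_code :: "stmt list" where
  "pass_code = pass_init @ [Loop (NLess 10 11) pass_body]"

definition scan_code :: "stmt list" where
  "scan_code = (scan_init @ [Loop (NLess 12 6) scan_body]) @ scan_final"

definition sums_code :: "stmt list" where
  "sums_code = clear @ pass_code @ scan_code"

definition search_code :: "stmt list" where
  "search_code = search_init @ [Loop (NLess 0 12) search_body]"

definition merge_code :: "stmt list" where
  "merge_code = merge_init @ [Loop (NLess 10 11) (merge_compute @ merge_write)]"

text \<open>
  The average is still 0 when \<open>sums_code\<close> runs first. Then every item is heavy and its surplus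
  is its weight, so this run computes the total weight.
\<close>

definition parallel_code :: "stmt list" where
  "parallel_code = sums_code @ set_avg @ sums_code @ pass_code @ search_code @ merge_code"

definition size_init :: "stmt list" where
  "size_init = [NConst 1 1, NLoad 2 0 0, NAdd 10 2 0, NConst 3 2, NConst 4 1]"

text \<open>One round per binary digit of \<open>n\<close>, that is \<open>L - 1\<close> rounds.
  Starting from 2, register 3 ends at \<open>2 ^ L\<close>, which exceeds \<open>2 * n\<close> and,
  being even, is at least \<open>2 * n + 2\<close>.\<close>

definition size_body :: "stmt list" where
  "size_body = [NHalf 10 10, NAdd 3 3 3, NAdd 4 4 1]"

text \<open>Register 11 holds \<open>L + 1\<close>, so that the strict test expresses
  \<open>2 * B \<le> L\<close>; the loop ends with \<open>B\<close> the largest power of two not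
  above \<open>L\<close>.\<close>

definition split_init :: "stmt list" where
  "split_init = [NConst 5 1, NAdd 6 3 0, NConst 10 2, NAdd 11 4 1]"

definition split_body :: "stmt list" where
  "split_body = [NAdd 5 5 5, NAdd 10 10 10, NHalf 6 6]"

definition fork_init :: "stmt list" where
  "fork_init = [NConst 9 1]"

text \<open>A new processor inherits register 7 from its activator, hence the renewed
  \<open>Pid\<close>.\<close>

definition fork_body :: "stmt list" where
  "fork_body = [NAdd 10 7 9] @ [Fork 10] @ [Pid 7, NAdd 9 9 9]"

definition base_init :: "stmt list" where
  "base_init = [NConst 10 1, NAdd 8 7 0]"

text \<open>Computes \<open>k * B\<close> by \<open>b\<close> doublings, as naturals cannot be
  multiplied.\<close>

definition base_body :: "stmt list" where
  "base_body = [NAdd 8 8 8, NAdd 10 10 10]"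

definition setup_code :: "stmt list" where
  "setup_code =
    (size_init @ [Loop (NLess 0 10) size_body]) @ (split_init @ [Loop (NLess 10 11) split_body]) @
    (fork_init @ [Loop (NLess 9 6) fork_body]) @ (base_init @ [Loop (NLess 10 5) base_body])"

context layout
begin

abbreviation "pass_time \<equiv> cost pass_init + (B * (cost pass_body + 1) + 1)"
abbreviation "scan_time \<equiv> cost scan_init + ((L - b) * (cost scan_body + 1) + 1) + cost scan_final"
abbreviation "sums_time \<equiv> cost clear + (pass_time + scan_time)"
abbreviation "search_time \<equiv> cost search_init + (L * (cost search_body + 1) + 1)"
abbreviation "merge_time \<equiv> cost merge_init + (B * (cost (merge_compute @ merge_write) + 1) + 1)"
abbreviation "parallel_time \<equiv>
  sums_time + (cost set_avg + (sums_time + (pass_time + (search_time + merge_time))))"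

lemma last_heavy_blocks:
  "Max (insert 0 ((\<lambda>i. last_heavy a v {i * B..<i * B + B}) ` {..<k})) = last_heavy a v {..<k * B}"
proof (induction k)
  case (Suc k)
  have *: "{..<Suc k * B} = {..<k * B} \<union> {k * B..<k * B + B}" by auto
  have "Max (insert 0 ((\<lambda>i. last_heavy a v {i * B..<i * B + B}) ` {..<Suc k})) =
      max (last_heavy a v {k * B..<k * B + B}) (Max (insert 0 ((\<lambda>i. last_heavy a v {i * B..<i * B + B}) ` {..<k})))"
    by (simp add: lessThan_Suc insert_commute[of 0])
  then show ?case unfolding Suc.IH * by (simp add: last_heavy_union max.commute)
qed simp

definition sums_known :: "real \<Rightarrow> state \<Rightarrow> bool" where
  "sums_known a = (\<lambda>(M, s, r). env M s r \<and>
     (\<forall>k<p. r k 1 = a \<and> r k 2 = sum (deficit a v) {..<k * B} \<and> r k 3 = sum (surplus a v) {..<k * B} \<and>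
       s k 9 = last_heavy a v {..<k * B} \<and> r k 4 = sum (surplus a v) {..<N}))"

lemma sums:
  assumes "env M s r" "\<And>k. k < p \<Longrightarrow> r k 1 = a"
  shows "wp p sums_code p sums_time (sums_known a) (M, s, r)"
  unfolding sums_code_def
proof (rule wp_append)
  define I where "I = (\<lambda>(M, s, r). env M s r \<and> (\<forall>k<p. r k 1 = a \<and> r k 2 = 0 \<and> r k 3 = 0 \<and> s k 9 = (0::nat)))"
  have "wps p clear I (M, s, r)"
    unfolding clear_def
    apply (rule wps_rules)+
    subgoal premises E using assms by (simp add: E I_def env_def)
    done
  then have clear: "wp p clear p (cost clear) I (M, s, r)" by (simp add: wps_def)
  let ?d = "\<lambda>k. sum (deficit a v) {k * B..<k * B + B}"
    and ?s = "\<lambda>k. sum (surplus a v) {k * B..<k * B + B}"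
    and ?l = "\<lambda>k. last_heavy a v {k * B..<k * B + B}"
  have pass: "wp p pass_code p pass_time (pass_inv a (\<lambda>_. 0) (\<lambda>_. 0) (\<lambda>_. 0) B) S" if "I S" for S
    using that pass[of _ _ _ a "\<lambda>_. 0" "\<lambda>_. 0" "\<lambda>_. 0"] by (cases S) (simp add: I_def pass_code_def)
  have scan: "wp p scan_code p scan_time (sums_known a) S" if "pass_inv a (\<lambda>_. 0) (\<lambda>_. 0) (\<lambda>_. 0) B S" for S
  proof -
    obtain M s r where S: "S = (M, s, r)" by (cases S)
    have "wp p scan_code p scan_time (scan_post a ?d ?s ?l) S"
      unfolding S scan_code_def using that by (intro scan) (simp_all add: S pass_inv_def)
    then show ?thesis
      by (rule wp_mono) (auto simp: scan_post_def sums_known_def last_heavy_blocks sum.nat_group)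
  qed
  show "wp p clear p (cost clear) (wp p (pass_code @ scan_code) p (pass_time + scan_time) (sums_known a)) (M, s, r)"
    using clear by (rule wp_mono) (rule wp_append, rule wp_mono[OF pass scan])
qed

lemma total: "sum (surplus 0 v) {..<N} = total_weight n v"
proof -
  have "sum (surplus 0 v) {..<N} = sum v {..<N}"
    using v_nonneg by (intro sum.cong) (auto simp: surplus_def order.order_iff_strict)
  also have "\<dots> = sum v {1..n}"
    using v_zero N_large by (intro sum.mono_neutral_right) auto
  finally show ?thesis by (simp add: total_weight_def)
qed

lemma parallel:
  assumes "env M s r" "\<And>k. k < p \<Longrightarrow> r k 1 = 0"
  shows "wp p parallel_code p parallel_time (merge_inv B) (M, s, r)"
proof -
  define I where "I = (\<lambda>(M, s, r). env M s r \<and> (\<forall>k<p. r k 1 = avg))"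
  have avg: "wp p set_avg p (cost set_avg) I S" if "sums_known 0 S" for S
  proof -
    obtain M s r where S: "S = (M, s, r)" by (cases S)
    have "wps p set_avg I (M, s, r)"
      unfolding set_avg_def
      apply (rule wps_rules)+
      subgoal premises E
        using that by (auto simp: E I_def env_def sums_known_def S total avg_def)
      done
    then show ?thesis by (simp add: wps_def S)
  qed
  have sums2: "wp p sums_code p sums_time (sums_known avg) S" if "I S" for S
    using that sums by (cases S) (auto simp: I_def)
  define K where "K = (\<lambda>(M, s, r). known M s r \<and> table_inv {} M)"
  have pass2: "wp p pass_code p pass_time K S" if "sums_known avg S" for S
  proof -
    obtain M s r where S: "S = (M, s, r)" by (cases S)
    let ?d = "\<lambda>k. sum (deficit avg v) {..<k * B}"
      and ?s = "\<lambda>k. sum (surplus avg v) {..<k * B}"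
      and ?l = "\<lambda>k. last_heavy avg v {..<k * B}"
    have "wp p pass_code p pass_time (pass_inv avg ?d ?s ?l B) S"
      unfolding S pass_code_def using that by (intro pass) (simp_all add: S sums_known_def)
    moreover have "K S" if "pass_inv avg ?d ?s ?l B S" for S
    proof -
      obtain M s r where S: "S = (M, s, r)" by (cases S)
      have un: "{..<x} = {..<k * B} \<union> {k * B..<x}" if "k * B \<le> x" for k x using that by auto
      have su: "sum f {..<k * B} + sum f {k * B..<x} = sum f {..<x}" if "k * B \<le> x" for f :: "nat \<Rightarrow> real" and k x
        unfolding un[OF that] by (rule sum.union_disjoint[symmetric]) auto
      have lu: "max (last_heavy avg v {..<k * B}) (last_heavy avg v {k * B..<x}) = last_heavy avg v {..<x}"
        if "k * B \<le> x" for k x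
        unfolding un[OF that] by (rule last_heavy_union[symmetric]) auto
      have "rmem M 2 c = X c \<and> rmem M 3 c = Y c \<and> nmem M 2 c = LH c \<and> rmem M 1 c = v c \<and> nmem M 1 c = c"
        if "c < N" for c
      proof -
        have "c div B < p" "c mod B < B" using that B_pos by (auto simp: less_mult_imp_div_less)
        moreover have "c div B * B \<le> c" "c div B * B \<le> Suc c" "c div B * B + c mod B = c"
          by (simp_all add: div_times_less_eq_dividend le_SucI)
        ultimately show ?thesis
          using \<open>pass_inv avg ?d ?s ?l B S\<close> su lu
          unfolding S pass_inv_def prod.case X_def Y_def LH_def by (metis (no_types, lifting))
      qed
      then show ?thesis
        using that by (auto simp: K_def S known_def table_inv_def pass_inv_def)
    qed
    ultimately show ?thesis by (rule wp_mono)
  qed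
  have search2: "wp p search_code p search_time (search_inv L) S" if "K S" for S
    using that search unfolding search_code_def by (cases S) (auto simp: K_def)
  have merge2: "wp p merge_code p merge_time (merge_inv B) S" if "search_inv L S" for S
    using that merge unfolding merge_code_def by blast
  show ?thesis
    unfolding parallel_code_def
    apply (rule wp_append, rule wp_mono[OF sums])
      apply (rule assms(1))
     apply (simp add: assms(2))
    apply (rule wp_append, rule wp_mono[OF avg], assumption)
    apply (rule wp_append, rule wp_mono[OF sums2], assumption)
    apply (rule wp_append, rule wp_mono[OF pass2], assumption)
    apply (rule wp_append, rule wp_mono[OF search2], assumption)
    by (rule merge2)
qed

end

section \<open>Activating the processors\<close>

locale machine = layout +
  fixes M0 :: memory
  assumes M0: "nmem M0 0 0 = n" "rmem M0 0 c = v c" "rmem M0 4 c = 0" "rmem M0 5 c = 0" "nmem M0 3 c = 0"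
    and L_pos: "0 < L" and n_less: "n < 2 ^ (L - 1)" and n_ge: "2 ^ (L - 1) \<le> 2 * n"
    and b_low: "2 ^ b \<le> L" and b_high: "L < 2 * 2 ^ b"
begin

abbreviation "size_time \<equiv> cost size_init + ((L - 1) * (cost size_body + 1) + 1)"
abbreviation "split_time \<equiv> cost split_init + (b * (cost split_body + 1) + 1)"
abbreviation "fork_time \<equiv> cost fork_init + ((L - b) * (1 + (1 + 2) + 1) + 1)"
abbreviation "base_time \<equiv> cost base_init + (b * (cost base_body + 1) + 1)"
abbreviation "setup_time \<equiv> size_time + (split_time + (fork_time + base_time))"

definition blank :: "nat \<Rightarrow> memory \<Rightarrow> (nat \<Rightarrow> nat \<Rightarrow> nat) \<Rightarrow> (nat \<Rightarrow> nat \<Rightarrow> real) \<Rightarrow> bool" where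
  "blank q M s r \<longleftrightarrow> M = M0 \<and> (\<forall>k<q. s k 0 = 0 \<and> s k 1 = 1 \<and> s k 2 = n \<and> s k 7 = k \<and> (\<forall>x. r k x = 0))"

definition size_inv :: "nat \<Rightarrow> state \<Rightarrow> bool" where
  "size_inv t = (\<lambda>(M, s, r). blank 1 M s r \<and> s 0 10 = n div 2 ^ t \<and> s 0 3 = 2 ^ Suc t \<and> s 0 4 = Suc t)"

lemma size:
  "wp 1 (size_init @ [Loop (NLess 0 10) size_body]) 1 size_time (size_inv (L - 1)) (M0, \<lambda>_ _. 0, \<lambda>_ _. 0)"
proof (rule wps_Loop_init[where I=size_inv])
  show "wps 1 size_init (size_inv 0) (M0, \<lambda>_ _. 0, \<lambda>_ _. 0)"
    unfolding size_init_def
    apply (rule wps_rules)+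
    subgoal premises E by (simp add: E size_inv_def blank_def M0)
    done
next
  fix t M s r assume t: "t < L - 1" and I: "size_inv t (M, s, r)"
  show "wps 1 size_body (size_inv (Suc t)) (M, s, r)"
    unfolding size_body_def
    apply (rule wps_rules)+
    subgoal premises E using I by (simp add: E size_inv_def blank_def div_mult2_eq mult.commute[of 2])
    done
  have "(2::nat) ^ Suc t \<le> 2 ^ (L - 1)" using t by (intro power_increasing) auto
  then have "2 ^ t \<le> n" using n_ge by simp
  then have "0 < n div 2 ^ t" by (simp add: div_greater_zero_iff)
  then show "holds (NLess 0 10) (s i) (r i)" if "i < 1" for i
    using that I by (simp add: size_inv_def blank_def)
next
  show "\<not> holds (NLess 0 10) (s i) (r i)" if "size_inv (L - 1) (M, s, r)" "i < 1" for M s r i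
    using that n_less by (simp add: size_inv_def blank_def)
qed

definition split_inv :: "nat \<Rightarrow> state \<Rightarrow> bool" where
  "split_inv t = (\<lambda>(M, s, r). blank 1 M s r \<and> s 0 3 = 2 ^ L \<and> s 0 5 = 2 ^ t \<and> s 0 6 = 2 ^ (L - t) \<and>
     s 0 10 = 2 ^ Suc t \<and> s 0 11 = Suc L)"

lemma splitting:
  assumes "size_inv (L - 1) (M, s, r)"
  shows "wp 1 (split_init @ [Loop (NLess 10 11) split_body]) 1 split_time (split_inv b) (M, s, r)"
proof (rule wps_Loop_init[where I=split_inv])
  show "wps 1 split_init (split_inv 0) (M, s, r)"
    unfolding split_init_def
    apply (rule wps_rules)+
    subgoal premises E using assms L_pos by (simp add: E split_inv_def size_inv_def blank_def)
    done
next
  fix t M s r assume t: "t < b" and I: "split_inv t (M, s, r)"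
  have "2 ^ (L - t) = 2 * (2::nat) ^ (L - Suc t)" using t b_le by (simp flip: power_Suc add: Suc_diff_Suc)
  then show "wps 1 split_body (split_inv (Suc t)) (M, s, r)"
    unfolding split_body_def
    apply -
    apply (rule wps_rules)+
    subgoal premises E using I E(1) by (simp add: E(2-) split_inv_def blank_def)
    done
  have "(2::nat) ^ Suc t \<le> 2 ^ b" using t by (intro power_increasing) auto
  then have "2 ^ Suc t \<le> L" using b_low by (rule order.trans)
  then show "holds (NLess 10 11) (s i) (r i)" if "i < 1" for i
    using that I by (simp add: split_inv_def)
next
  show "\<not> holds (NLess 10 11) (s i) (r i)" if "split_inv b (M, s, r)" "i < 1" for M s r i
    using that b_high by (simp add: split_inv_def)
qed

definition fork_inv :: "nat \<Rightarrow> state \<Rightarrow> bool" where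
  "fork_inv t = (\<lambda>(M, s, r). blank (2 ^ t) M s r \<and>
     (\<forall>k<2 ^ t. s k 3 = N \<and> s k 5 = B \<and> s k 6 = p \<and> s k 9 = 2 ^ t))"

lemma fork_body:
  assumes "fork_inv t (M, s, r)"
  shows "wp (2 ^ t) fork_body (2 ^ Suc t) (1 + (1 + 2)) (fork_inv (Suc t)) (M, s, r)"
proof -
  define J :: "state \<Rightarrow> bool" where "J = (\<lambda>(M, s, r). fork_inv t (M, s, r) \<and> (\<forall>k<2 ^ t. s k 10 = k + (2::nat) ^ t))"
  \<comment> \<open>Register 7 is absent here: just after the fork, half of the processors still
    hold a foreign number.\<close>
  define J' :: "state \<Rightarrow> bool" where "J' = (\<lambda>(M, s, r). M = M0 \<and> (\<forall>k<2 ^ t + 2 ^ t. s k 0 = 0 \<and> s k 1 = 1 \<and> s k 2 = n \<and>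
    (\<forall>x. r k x = (0::real)) \<and> s k 3 = N \<and> s k 5 = B \<and> s k 6 = p \<and> s k 9 = (2::nat) ^ t))"
  have "wps (2 ^ t) [NAdd 10 7 9] J (M, s, r)"
    apply (rule wps_rules)+
    subgoal premises E using assms by (simp add: E J_def fork_inv_def blank_def)
    done
  then have 1: "wp (2 ^ t) [NAdd 10 7 9] (2 ^ t) 1 J (M, s, r)" by (simp add: wps_def)
  have 2: "wp (2 ^ t) [Fork 10] (2 ^ t + 2 ^ t) 1 J' S" if "J S" for S
  proof -
    obtain M s r where S: "S = (M, s, r)" by (cases S)
    show ?thesis unfolding S
      by (rule wp_Fork) (use that in \<open>auto simp: S J_def J'_def fork_inv_def blank_def\<close>)
  qed
  have 3: "wp (2 ^ t + 2 ^ t) [Pid 7, NAdd 9 9 9] (2 ^ t + 2 ^ t) 2 (fork_inv (Suc t)) S" if "J' S" for S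
  proof -
    obtain M s r where S: "S = (M, s, r)" by (cases S)
    have "wps (2 ^ t + 2 ^ t) [Pid 7, NAdd 9 9 9] (fork_inv (Suc t)) (M, s, r)"
      apply (rule wps_rules)+
      subgoal premises E using that by (simp add: E S J'_def fork_inv_def blank_def)
      done
    then show ?thesis by (simp add: wps_def S)
  qed
  have "(2::nat) ^ Suc t = 2 ^ t + 2 ^ t" by simp
  then show ?thesis
    unfolding fork_body_def
    by (simp only:) (rule wp_append, rule wp_mono[OF 1], rule wp_append, rule wp_mono[OF 2 3])
qed

lemma forking:
  assumes "split_inv b (M, s, r)"
  shows "wp 1 (fork_init @ [Loop (NLess 9 6) fork_body]) p fork_time (fork_inv (L - b)) (M, s, r)"
proof (rule wp_append, rule wp_mono)
  have "wps 1 fork_init (fork_inv 0) (M, s, r)"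
    unfolding fork_init_def
    apply (rule wps_rules)+
    subgoal premises E
      using assms by (simp add: E fork_inv_def split_inv_def blank_def N_eq, simp add: B_def p_def)
    done
  then show "wp 1 fork_init 1 (cost fork_init) (fork_inv 0) (M, s, r)" by (simp only: wps_def)
  show "wp 1 [Loop (NLess 9 6) fork_body] p ((L - b) * (1 + (1 + 2) + 1) + 1) (fork_inv (L - b)) S"
    if "fork_inv 0 S" for S
  proof -
    have "wp (2 ^ 0) [Loop (NLess 9 6) fork_body] (2 ^ (L - b)) ((L - b) * (1 + (1 + 2) + 1) + 1) (fork_inv (L - b)) S"
    proof (rule wp_Loop[where q="\<lambda>t. 2 ^ t" and I=fork_inv])
      show "holds (NLess 9 6) (s i) (r i)" if "t < L - b" "fork_inv t (M, s, r)" "i < 2 ^ t" for t M s r i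
        using that by (simp add: fork_inv_def) (simp add: p_def)
      show "\<not> holds (NLess 9 6) (s i) (r i)" if "fork_inv (L - b) (M, s, r)" "i < 2 ^ (L - b)" for M s r i
        using that by (simp add: fork_inv_def) (simp add: p_def)
    qed (use that fork_body in auto)
    then show ?thesis by (simp add: p_def)
  qed
qed

definition base_inv :: "nat \<Rightarrow> state \<Rightarrow> bool" where
  "base_inv t = (\<lambda>(M, s, r). blank p M s r \<and>
     (\<forall>k<p. s k 3 = N \<and> s k 5 = B \<and> s k 6 = p \<and> s k 8 = k * 2 ^ t \<and> s k 10 = 2 ^ t))"

lemma base:
  assumes "fork_inv (L - b) (M, s, r)"
  shows "wp p (base_init @ [Loop (NLess 10 5) base_body]) p base_time (base_inv b) (M, s, r)"
proof (rule wps_Loop_init[where I=base_inv])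
  show "wps p base_init (base_inv 0) (M, s, r)"
    unfolding base_init_def
    apply (rule wps_rules)+
    subgoal premises E using assms by (simp add: E fork_inv_def base_inv_def blank_def flip: p_def)
    done
next
  fix t M s r assume t: "t < b" and I: "base_inv t (M, s, r)"
  show "wps p base_body (base_inv (Suc t)) (M, s, r)"
    unfolding base_body_def
    apply (rule wps_rules)+
    subgoal premises E using I by (simp add: E base_inv_def blank_def)
    done
  show "holds (NLess 10 5) (s i) (r i)" if "i < p" for i
    using that I t by (simp add: base_inv_def) (simp add: B_def)
next
  show "\<not> holds (NLess 10 5) (s i) (r i)" if "base_inv b (M, s, r)" "i < p" for M s r i
    using that by (simp add: base_inv_def) (simp add: B_def)
qed

lemma activation:
  "wp 1 setup_code p setup_time (\<lambda>(M, s, r). env M s r \<and> (\<forall>k<p. r k 1 = 0)) (M0, \<lambda>_ _. 0, \<lambda>_ _. 0)"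
proof -
  have splitting': "wp 1 (split_init @ [Loop (NLess 10 11) split_body]) 1 split_time (split_inv b) S"
    if "size_inv (L - 1) S" for S using that splitting by (cases S) auto
  have forking': "wp 1 (fork_init @ [Loop (NLess 9 6) fork_body]) p fork_time (fork_inv (L - b)) S"
    if "split_inv b S" for S using that forking by (cases S) auto
  have base': "wp p (base_init @ [Loop (NLess 10 5) base_body]) p base_time
      (\<lambda>(M, s, r). env M s r \<and> (\<forall>k<p. r k 1 = 0)) S" if "fork_inv (L - b) S" for S
  proof -
    have "wp p (base_init @ [Loop (NLess 10 5) base_body]) p base_time (base_inv b) S"
      using that base by (cases S) auto
    then show ?thesis
      by (rule wp_mono) (auto simp: base_inv_def blank_def env_def M0 simp flip: B_def)
  qed
  show ?thesis
    unfolding setup_code_def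
    apply (rule wp_append, rule wp_mono[OF size])
    apply (rule wp_append, rule wp_mono[OF splitting'], assumption)
    apply (rule wp_append, rule wp_mono[OF forking'], assumption)
    by (rule base')
qed

declare One_nat_def [simp]

lemma correct_run:
  assumes C0: "rep 1 (\<lambda>_. setup_code @ parallel_code) (M0, \<lambda>_ _. 0, \<lambda>_ _. 0) C0"
    and w: "\<And>i. i \<in> {1..n} \<Longrightarrow> w i = v i"
  shows "\<exists>C wk t. crew_run C0 wk t C \<and> alias_table n w (output_table C) \<and>
    n \<le> wk \<and> wk \<le> 4000 * n \<and> L \<le> t + 1 \<and> t \<le> 500 * L"
proof -
  define Q :: "state \<Rightarrow> bool" where "Q = (\<lambda>(M, s, r). env M s r \<and> (\<forall>k<p. r k 1 = 0))"
  have "wp 1 setup_code p setup_time Q (M0, \<lambda>_ _. 0, \<lambda>_ _. 0)" unfolding Q_def by (rule activation)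
  from this[unfolded wp_def] C0 obtain C1 S1 wk1 where 1: "Q S1"
    "rep p (\<lambda>_. parallel_code) S1 C1" "steps C0 wk1 setup_time C1" "wk1 \<le> p * setup_time"
    using zero_less_one by blast
  obtain M1 s1 r1 where S1: "S1 = (M1, s1, r1)" by (cases S1)
  have "wp p parallel_code p parallel_time (merge_inv B) S1"
    unfolding S1 using 1(1) by (intro parallel) (auto simp: S1 Q_def)
  from this[unfolded wp_def] 1(2) p_pos obtain C2 S2 wk2 where 2: "merge_inv B S2" "rep p (\<lambda>_. []) S2 C2"
    "steps C1 wk2 parallel_time C2" "p * parallel_time \<le> wk2" "wk2 \<le> p * parallel_time"
    by (metis append_Nil2)
  have "fst (snd C2 i) = []" for i using 2(2) by (cases S2; cases "i < p") (simp_all add: rep_def)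
  then have "active C2 = {}" by (simp add: active_def)
  then have run: "crew_run C0 (wk1 + wk2) (setup_time + parallel_time) C2"
    by (rule crew_run_steps[OF steps_trans[OF 1(3) 2(3)]])
  obtain M2 s2 r2 where S2: "S2 = (M2, s2, r2)" by (cases S2)
  have "C2 = (M2, snd C2)" using 2(2) by (cases C2) (simp add: rep_def S2)
  then have table: "alias_table n w (output_table C2)"
    using merge_result[of M2 s2 r2 w "snd C2"] 2(1) w S2 by metis
  have B_L: "B \<le> L" "L \<le> 2 * B" "b \<le> L" using b_low b_high b_le by (simp_all add: B_def)
  \<comment> \<open>Each loop runs at most \<open>L\<close> rounds, and \<open>1 \<le> L\<close>
    absorbs the constant parts; 500 is a generous bound for the instruction counts.\<close>
  have up: "setup_time + parallel_time \<le> 500 * L"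
    using B_L L_pos
    by (simp add: size_init_def size_body_def split_init_def split_body_def fork_init_def base_init_def base_body_def
        clear_def pass_init_def pass_body_def scan_init_def scan_body_def scan_final_def set_avg_def
        search_init_def search_body_def merge_init_def merge_compute_def merge_write_def)
  have low: "L \<le> setup_time + parallel_time + 1"
  proof -
    \<comment> \<open>The loop that computes the padded size alone forces logarithmic span.\<close>
    have "L - 1 \<le> (L - 1) * (cost size_body + 1)" by simp
    then show ?thesis by linarith
  qed
  have "B \<le> B * (cost pass_body + 1)" by simp
  then have "B \<le> parallel_time" by linarith
  then have "p * B \<le> p * parallel_time" by (rule mult_le_mono2)
  then have wlow: "n \<le> wk1 + wk2" using N_large 2(4) by linarith
  have N4: "N \<le> 4 * n"
  proof -
    have "(2::nat) ^ L = 2 * 2 ^ (L - 1)" using L_pos by (cases L) auto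
    then show ?thesis using n_ge N_eq by simp
  qed
  have "wk1 + wk2 \<le> p * (setup_time + parallel_time)"
    using 1(4) 2(5) unfolding distrib_left by linarith
  \<comment> \<open>Here \<open>L \<le> 2 * B\<close> pays off: \<open>p\<close> processors running
    for O(L) steps do only O(N) work.\<close>
  also have "\<dots> \<le> p * (500 * (2 * B))" using up B_L by (intro mult_le_mono2) linarith
  also have "\<dots> = 1000 * N" by simp
  also have "\<dots> \<le> 4000 * n" using N4 by linarith
  finally show ?thesis using run table low up wlow by blast
qed

end

section \<open>Choice of parameters and asymptotics\<close>

lemma power_two_bracket:
  fixes n :: nat
  assumes "1 \<le> n"
  shows "\<exists>l. n < 2 ^ l \<and> 2 ^ l \<le> 2 * n"
proof -
  define l where "l = (LEAST l. n < 2 ^ l)"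
  have l: "n < 2 ^ l" unfolding l_def by (rule LeastI[of _ n]) (rule less_exp)
  then obtain m where m: "l = Suc m" using assms by (cases l) auto
  then have "\<not> n < 2 ^ m" using not_less_Least[of m "\<lambda>l. n < 2 ^ l"] by (simp add: l_def)
  then show ?thesis using l m by (intro exI[of _ l]) simp
qed

lemma alias_table_run:
  assumes "(n, w) \<in> instances"
  shows "\<exists>C wk t L. crew_run (input_config (setup_code @ parallel_code) n w) wk t C \<and>
    alias_table n w (output_table C) \<and> n \<le> wk \<and> wk \<le> 4000 * n \<and> L \<le> t \<and> t \<le> 500 * Suc L \<and>
    n < 2 ^ L \<and> 2 ^ L \<le> 2 * n"
proof -
  have n: "1 \<le> n" and w: "\<And>i. i \<in> {1..n} \<Longrightarrow> 0 < w i" using assms by (auto simp: instances_def)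
  obtain l where l: "n < 2 ^ l" "2 ^ l \<le> 2 * n" using power_two_bracket[OF n] by blast
  \<comment> \<open>The same bracket for \<open>L = Suc l\<close>; with \<open>b' = Suc b\<close> it
    says that \<open>2 ^ b\<close> is at most \<open>L\<close> and \<open>2 * 2 ^ b\<close> is above
    it.\<close>
  obtain b' where b': "Suc l < 2 ^ b'" "2 ^ b' \<le> 2 * Suc l" using power_two_bracket[of "Suc l"] by auto
  then obtain b where b: "b' = Suc b" by (cases b') auto
  define v where "v i = (if i \<in> {1..n} then w i else 0)" for i
  let ?C0 = "input_config (setup_code @ parallel_code) n w"
  interpret machine n v "Suc l" b "2 ^ b" "2 ^ (Suc l - b)" "fst ?C0"
  proof
    show "b \<le> Suc l"
    proof -
      have "b < 2 ^ b" by (rule less_exp)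
      also have "\<dots> \<le> Suc l" using b'(2) by (simp add: b)
      finally show ?thesis by simp
    qed
  qed (use n w l b b' in \<open>auto simp: v_def input_config_def\<close>)
  have "rep 1 (\<lambda>_. setup_code @ parallel_code) (fst ?C0, \<lambda>_ _. 0, \<lambda>_ _. 0) ?C0"
    by (simp add: rep_def input_config_def)
  from correct_run[OF this, of w] obtain C wk t where "crew_run ?C0 wk t C" "alias_table n w (output_table C)"
    "n \<le> wk" "wk \<le> 4000 * n" "Suc l \<le> t + 1" "t \<le> 500 * Suc l"
    by (auto simp: v_def)
  then show ?thesis
    using l by (intro exI[of _ C] exI[of _ wk] exI[of _ t] exI[of _ l]) simp
qed

theorem theorem1:
  shows "\<exists>P work span.
    (\<forall>(n, w)\<in>instances. \<exists>C.
       crew_run (input_config P n w) (work (n, w)) (span (n, w)) C \<and>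
       alias_table n w (output_table C)) \<and>
    (\<lambda>x. real (work x)) \<in> \<Theta>[large_instances](\<lambda>(n, w). real n) \<and>
    (\<lambda>x. real (span x)) \<in> \<Theta>[large_instances](\<lambda>(n, w). ln (real n))"
proof -
  let ?P = "setup_code @ parallel_code"
  have "\<forall>x\<in>instances. \<exists>wk t. \<exists>C L. crew_run (input_config ?P (fst x) (snd x)) wk t C \<and>
      alias_table (fst x) (snd x) (output_table C) \<and> fst x \<le> wk \<and> wk \<le> 4000 * fst x \<and>
      L \<le> t \<and> t \<le> 500 * Suc L \<and> fst x < 2 ^ L \<and> 2 ^ L \<le> 2 * fst x"
    using alias_table_run by fastforce
  then obtain work span where run: "\<And>x. x \<in> instances \<Longrightarrow> \<exists>C L. crew_run (input_config ?P (fst x) (snd x)) (work x) (span x) C \<and>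
      alias_table (fst x) (snd x) (output_table C) \<and> fst x \<le> work x \<and> work x \<le> 4000 * fst x \<and>
      L \<le> span x \<and> span x \<le> 500 * Suc L \<and> fst x < 2 ^ L \<and> 2 ^ L \<le> 2 * fst x"
    by metis
  \<comment> \<open>Both bounds come from \<open>ln x \<le> x - 1\<close>, at 1/2 and at 2.\<close>
  have ln2: "1 / 2 \<le> ln (2::real)" "ln (2::real) \<le> 1"
    using ln_le_minus_one[of "1 / 2 :: real"] ln_le_minus_one[of "2 :: real"] by (simp_all add: ln_div)
  have span: "ln (real (fst x)) \<le> span x \<and> span x \<le> 2000 * ln (real (fst x))"
    if x: "x \<in> instances" "3 \<le> fst x" for x
  proof -
    obtain L where L: "L \<le> span x" "span x \<le> 500 * Suc L" "fst x < 2 ^ L" "2 ^ L \<le> 2 * fst x"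
      using run[OF x(1)] by blast
    have pos: "0 < real (fst x)" using x(2) by simp
    have "real (fst x) \<le> 2 ^ L" using L(3) by (metis less_imp_le of_nat_le_iff of_nat_numeral of_nat_power)
    then have "ln (real (fst x)) \<le> L * ln 2" using pos by (metis ln_mono ln_realpow zero_less_numeral)
    also have "\<dots> \<le> real L * 1" using ln2 by (intro mult_left_mono) auto
    finally have lo: "ln (real (fst x)) \<le> span x" using L(1) by simp
    have "2 ^ L \<le> 2 * real (fst x)" using L(4) by (metis of_nat_le_iff of_nat_mult of_nat_numeral of_nat_power)
    then have "L * ln 2 \<le> ln (2 * real (fst x))" using pos by (metis ln_mono ln_realpow zero_less_numeral zero_less_power)
    then have "(real L - 1) * ln 2 \<le> ln (real (fst x))" using pos by (simp add: ln_mult algebra_simps)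
    moreover have "real L - 1 \<le> 2 * ((real L - 1) * ln 2)"
    proof -
      have "1 \<le> L" using L(3) x(2) by (cases L) auto
      then have "(real L - 1) * (1 / 2) \<le> (real L - 1) * ln 2" using ln2 by (intro mult_left_mono) auto
      then show ?thesis by simp
    qed
    ultimately have "real L \<le> 1 + 2 * ln (real (fst x))" by linarith
    moreover have "1 \<le> ln (real (fst x))"
    proof -
      have "exp 1 \<le> (3::real)" using exp_le .
      also have "3 \<le> real (fst x)" using x(2) by simp
      finally show ?thesis using pos by (simp add: ln_ge_iff)
    qed
    moreover have "real (span x) \<le> 500 * (1 + real L)" using L(2) by (metis of_nat_Suc of_nat_le_iff of_nat_mult of_nat_numeral)
    \<comment> \<open>From \<open>500 * (1 + L)\<close> and \<open>L \<le> 1 + 2 * ln n\<close> one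
      gets \<open>1000 + 1000 * ln n\<close>; as \<open>n \<ge> 3 \<ge> exp 1\<close>, the first
      summand is at most \<open>1000 * ln n\<close>.\<close>
    ultimately have "span x \<le> 2000 * ln (real (fst x))" by argo
    with lo show ?thesis by blast
  qed
  have "(\<lambda>x. real (work x)) \<in> \<Theta>[large_instances](\<lambda>(n, w). real n)"
  proof (rule bigthetaI')
    show "eventually (\<lambda>x. 1 * norm (case x of (n, w) \<Rightarrow> real n) \<le> norm (real (work x)) \<and>
        norm (real (work x)) \<le> 4000 * norm (case x of (n, w) \<Rightarrow> real n)) large_instances"
      unfolding eventually_large_instances using run by (intro exI[of _ 0]) fastforce
  qed auto
  moreover have "(\<lambda>x. real (span x)) \<in> \<Theta>[large_instances](\<lambda>(n, w). ln (real n))"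
  proof (rule bigthetaI')
    show "eventually (\<lambda>x. 1 * norm (case x of (n, w) \<Rightarrow> ln (real n)) \<le> norm (real (span x)) \<and>
        norm (real (span x)) \<le> 2000 * norm (case x of (n, w) \<Rightarrow> ln (real n))) large_instances"
      unfolding eventually_large_instances using span by (intro exI[of _ 3]) fastforce
  qed auto
  moreover have "\<forall>(n, w)\<in>instances. \<exists>C. crew_run (input_config ?P n w) (work (n, w)) (span (n, w)) C \<and>
       alias_table n w (output_table C)"
    using run by fastforce
  ultimately show ?thesis by blast
qed

end
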